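(* Let $\mathrm{Sym}(\ell)\subseteq\mathrm{Sym}(m)\subseteq\mathrm{Sym}(n)$ with $\ell<m\le n$, and for $i\in\{m,\ell\}$ put $\eta(i)=\dfrac{\alpha i}{2+2\alpha(i-2)}$. The coset axis $x_{\mathrm{Sym}(m)/\mathrm{Sym}(\ell)}$ in $A=A^\alpha_3(\mathrm{Sym}(n),D)$ satisfies the fusion rules $\Phi=\{1,\,0,\,\eta(m),\,1-\eta(\ell),\,\eta(m)-\eta(\ell)\}$ with the symmetric map $\star$ given by \begin{itemize} \item $1\star 1=\{1\}$, $1\star 0=\emptyset$, $0\star 0=\{0\}$; \item $1\star\lambda=0\star\lambda=\{\lambda\}$ for $\lambda\in\{\eta(m),\,1-\eta(\ell),\,\eta(m)-\eta(\ell)\}$; \item $\eta(m)\star\eta(m)=\{1,0,\eta(m)\}$; \item $\eta(m)\star(1-\eta(\ell))=\{\eta(m)-\eta(\ell)\}$; \item $\eta(m)\star(\eta(m)-\eta(\ell))=\{1-\eta(\ell),\,\eta(m)-\eta(\ell)\}$; \item $(1-\eta(\ell))\star(1-\eta(\ell))=\{1,0,1-\eta(\ell)\}$; \item $(1-\eta(\ell))\star(\eta(m)-\eta(\ell))=\{\eta(m),\,\eta(m)-\eta(\ell)\}$; \item $(\eta(m)-\eta(\ell))\star(\eta(m)-\eta(\ell))=\{1,\,0,\,\eta(m),\,1-\eta(\ell),\,\eta(m)-\eta(\ell)\}$. \end{itemize}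
   Context: Let $\mathbb F$ be a field and $\alpha\in\mathbb F\setminus\{0,1\}$. Let $D$ be the set of transpositions of $\mathrm{Sym}(n)$ and write $c^d=d^{-1}cd$. The algebra $A=A^\alpha_3(\mathrm{Sym}(n),D)$ is the commutative, not necessarily associative, $\mathbb F$-algebra with basis $\{d^\rho\mid d\in D\}$ and multiplication $$c^\rho d^\rho=\begin{cases} d^\rho & c=d,\\ 0 & c\ne d,\ [c,d]=1,\\ \frac{\alpha}{2}\bigl(c^\rho+d^\rho-(c^d)^\rho\bigr) & \text{otherwise.}\end{cases}$$ For $i\le n$, let $\mathrm{id}_i$ be the identity element of the subalgebra generated by the $d^\rho$ with $d\in D\cap\mathrm{Sym}(i)$, namely $\mathrm{id}_i=\frac{1}{1+\alpha(i-2)}\sum_{d\in D\cap\mathrm{Sym}(i)}d^\rho$. The coset axis, defined when the subalgebras for $m$ and $\ell$ admit identity elements, is $x_{\mathrm{Sym}(m)/\mathrm{Sym}(\ell)}=\mathrm{id}_m-\mathrm{id}_\ell$. For $a\in A$ and $\lambda\in\mathbb F$, $A^a_\lambda=\{b\in A\mid ab=\lambda b\}$, and for a subset $\Lambda\subseteq\mathbb F$, $A^a_\Lambda=\sum_{\lambda\in\Lambda}A^a_\lambda$. A fusion rules is a finite set $\Phi\subseteq\mathbb F$ with a map $\star\colon\Phi\times\Phi\to2^\Phi$. An element $x$ satisfies the fusion rules $\Phi$ (is a $\Phi$-axis) if it is a semisimple idempotent with $A=\bigoplus_{\lambda\in\Phi}A^x_\lambda$ and $A^x_\lambda A^x_\mu\subseteq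 A^x_{\lambda\star\mu}$ for all $\lambda,\mu\in\Phi$.
   Formalization: The field is assumed to have characteristic not 2, and the five values 1, 0, η(m), 1−η(ℓ), η(m)−η(ℓ) are assumed pairwise distinct; otherwise the table does not define a map ⋆ (e.g. α=2, m=3 gives η(m)=1, so 1⋆0 would be both ∅ and {1}). *)

theory Defs
  imports
    "HOL-Combinatorics.Permutations"
    "HOL-Library.FuncSet"
    "HOL-Library.Function_Algebras"
begin

section \<open>The algebra attached to a set of 3-transpositions\<close>

text \<open>
  A vector of the free module on \<open>D\<close> is a function on permutations that vanishes outside \<open>D\<close>;
  addition is pointwise, and \<open>rho d\<close> is the basis vector attached to \<open>d\<close>.
  The product \<open>mprod\<close> below is only meaningful for finite \<open>D\<close>.
\<close>

type_synonym perm = "nat \<Rightarrow> nat"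

definition scl :: "'f::field \<Rightarrow> (perm \<Rightarrow> 'f) \<Rightarrow> perm \<Rightarrow> 'f" where
  "scl r a = (\<lambda>e. r * a e)"

definition rho :: "perm \<Rightarrow> perm \<Rightarrow> 'f::field" where
  "rho d = (\<lambda>e. if e = d then 1 else 0)"

definition alg :: "perm set \<Rightarrow> (perm \<Rightarrow> 'f::field) set" where
  "alg D = {a. \<forall>e. e \<notin> D \<longrightarrow> a e = 0}"

definition conj_by :: "perm \<Rightarrow> perm \<Rightarrow> perm" where
  "conj_by c d = inv d \<circ> c \<circ> d"

definition basis_prod :: "'f::field \<Rightarrow> perm \<Rightarrow> perm \<Rightarrow> perm \<Rightarrow> 'f" where
  "basis_prod \<alpha> c d =
     (if c = d then rho d
      else if c \<circ> d = d \<circ> c then 0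
      else scl (\<alpha> / 2) (rho c + rho d - rho (conj_by c d)))"

definition mprod :: "'f::field \<Rightarrow> perm set \<Rightarrow> (perm \<Rightarrow> 'f) \<Rightarrow> (perm \<Rightarrow> 'f) \<Rightarrow> perm \<Rightarrow> 'f" where
  "mprod \<alpha> D a b = (\<Sum>c\<in>D. \<Sum>d\<in>D. scl (a c * b d) (basis_prod \<alpha> c d))"

inductive_set subalg :: "'f::field \<Rightarrow> perm set \<Rightarrow> (perm \<Rightarrow> 'f) set \<Rightarrow> (perm \<Rightarrow> 'f) set"
  for \<alpha> D X where
  gen: "a \<in> X \<Longrightarrow> a \<in> subalg \<alpha> D X"
| zero: "0 \<in> subalg \<alpha> D X"
| add: "a \<in> subalg \<alpha> D X \<Longrightarrow> b \<in> subalg \<alpha> D X \<Longrightarrow> a + b \<in> subalg \<alpha> D X"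
| scale: "a \<in> subalg \<alpha> D X \<Longrightarrow> scl r a \<in> subalg \<alpha> D X"
| mult: "a \<in> subalg \<alpha> D X \<Longrightarrow> b \<in> subalg \<alpha> D X \<Longrightarrow> mprod \<alpha> D a b \<in> subalg \<alpha> D X"

definition is_identity ::
  "'f::field \<Rightarrow> perm set \<Rightarrow> (perm \<Rightarrow> 'f) set \<Rightarrow> (perm \<Rightarrow> 'f) \<Rightarrow> bool" where
  "is_identity \<alpha> D B e \<longleftrightarrow> e \<in> B \<and> (\<forall>b\<in>B. mprod \<alpha> D e b = b \<and> mprod \<alpha> D b e = b)"


section \<open>Eigenspaces and fusion rules\<close>

definition eigenspace ::
  "'f::field \<Rightarrow> perm set \<Rightarrow> (perm \<Rightarrow> 'f) \<Rightarrow> 'f \<Rightarrow> (perm \<Rightarrow> 'f) set" where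
  "eigenspace \<alpha> D a \<kappa> = {b \<in> alg D. mprod \<alpha> D a b = scl \<kappa> b}"

definition eigenspace_sum ::
  "'f::field \<Rightarrow> perm set \<Rightarrow> (perm \<Rightarrow> 'f) \<Rightarrow> 'f set \<Rightarrow> (perm \<Rightarrow> 'f) set" where
  "eigenspace_sum \<alpha> D a \<Lambda> =
     {(\<Sum>\<kappa>\<in>T. f \<kappa>) | T f. finite T \<and> T \<subseteq> \<Lambda> \<and> (\<forall>\<kappa>\<in>T. f \<kappa> \<in> eigenspace \<alpha> D a \<kappa>)}"

definition fusion_rules :: "'f set \<Rightarrow> ('f \<Rightarrow> 'f \<Rightarrow> 'f set) \<Rightarrow> bool" where
  "fusion_rules \<Phi> star \<longleftrightarrow> finite \<Phi> \<and> (\<forall>\<kappa>\<in>\<Phi>. \<forall>\<mu>\<in>\<Phi>. star \<kappa> \<mu> \<subseteq> \<Phi>)"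

text \<open>
  The fourth conjunct says that \<open>alg D\<close> is the direct sum of the eigenspaces of \<open>x\<close> for the
  eigenvalues in \<open>\<Phi>\<close>; in particular \<open>x\<close> is semisimple.
\<close>

definition satisfies_fusion_rules ::
  "'f::field \<Rightarrow> perm set \<Rightarrow> 'f set \<Rightarrow> ('f \<Rightarrow> 'f \<Rightarrow> 'f set) \<Rightarrow> (perm \<Rightarrow> 'f) \<Rightarrow> bool" where
  "satisfies_fusion_rules \<alpha> D \<Phi> star x \<longleftrightarrow>
     fusion_rules \<Phi> star \<and>
     x \<in> alg D \<and>
     mprod \<alpha> D x x = x \<and>
     (\<forall>b\<in>alg D. \<exists>!f. f \<in> (\<Pi>\<^sub>E \<kappa>\<in>\<Phi>. eigenspace \<alpha> D x \<kappa>) \<and> b = (\<Sum>\<kappa>\<in>\<Phi>. f \<kappa>)) \<and>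
     (\<forall>\<kappa>\<in>\<Phi>. \<forall>\<mu>\<in>\<Phi>. \<forall>a\<in>eigenspace \<alpha> D x \<kappa>. \<forall>b\<in>eigenspace \<alpha> D x \<mu>.
        mprod \<alpha> D a b \<in> eigenspace_sum \<alpha> D x (star \<kappa> \<mu>))"


section \<open>Coset axes for symmetric groups\<close>

definition Sym :: "nat \<Rightarrow> perm set" where
  "Sym i = {p. p permutes {1..i}}"

definition transps :: "nat \<Rightarrow> perm set" where
  "transps n = {transpose a b | a b. a \<in> {1..n} \<and> b \<in> {1..n} \<and> a \<noteq> b}"

definition sym_subalg :: "nat \<Rightarrow> 'f::field \<Rightarrow> nat \<Rightarrow> (perm \<Rightarrow> 'f) set" where
  "sym_subalg n \<alpha> i = subalg \<alpha> (transps n) (rho ` (transps n \<inter> Sym i))"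

definition admits_id :: "nat \<Rightarrow> 'f::field \<Rightarrow> nat \<Rightarrow> bool" where
  "admits_id n \<alpha> i \<longleftrightarrow> (\<exists>e. is_identity \<alpha> (transps n) (sym_subalg n \<alpha> i) e)"

definition id_elt :: "nat \<Rightarrow> 'f::field \<Rightarrow> nat \<Rightarrow> perm \<Rightarrow> 'f" where
  "id_elt n \<alpha> i = (THE e. is_identity \<alpha> (transps n) (sym_subalg n \<alpha> i) e)"

definition coset_axis :: "nat \<Rightarrow> 'f::field \<Rightarrow> nat \<Rightarrow> nat \<Rightarrow> perm \<Rightarrow> 'f" where
  "coset_axis n \<alpha> m l = id_elt n \<alpha> m - id_elt n \<alpha> l"

definition eta :: "'f::field \<Rightarrow> nat \<Rightarrow> 'f" where
  "eta \<alpha> i = \<alpha> * of_nat i / (2 + 2 * \<alpha> * (of_nat i - 2))"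

text \<open>
  The fusion table, with \<open>p\<close> and \<open>q\<close> standing for \<open>eta \<alpha> m\<close> and \<open>eta \<alpha> l\<close>. A triple
  \<open>(\<kappa>, \<mu>, S)\<close> records that \<open>\<kappa> \<star> \<mu> = \<mu> \<star> \<kappa> = S\<close>.
\<close>

definition coset_eigenvalues :: "'f::field \<Rightarrow> 'f \<Rightarrow> 'f list" where
  "coset_eigenvalues p q = [1, 0, p, 1 - q, p - q]"

definition coset_table :: "'f::field \<Rightarrow> 'f \<Rightarrow> ('f \<times> 'f \<times> 'f set) set" where
  "coset_table p q =
    {(1, 1, {1}),
     (1, 0, {}),
     (0, 0, {0}),
     (1, p, {p}), (1, 1 - q, {1 - q}), (1, p - q, {p - q}),
     (0, p, {p}), (0, 1 - q, {1 - q}), (0, p - q, {p - q}),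
     (p, p, {1, 0, p}),
     (p, 1 - q, {p - q}),
     (p, p - q, {1 - q, p - q}),
     (1 - q, 1 - q, {1, 0, 1 - q}),
     (1 - q, p - q, {p, p - q}),
     (p - q, p - q, {1, 0, p, 1 - q, p - q})}"

definition realizes_table ::
  "('f \<times> 'f \<times> 'f set) set \<Rightarrow> ('f \<Rightarrow> 'f \<Rightarrow> 'f set) \<Rightarrow> bool" where
  "realizes_table T star \<longleftrightarrow> (\<forall>(\<kappa>, \<mu>, S)\<in>T. star \<kappa> \<mu> = S \<and> star \<mu> \<kappa> = S)"

definition table_star :: "('f \<times> 'f \<times> 'f set) set \<Rightarrow> 'f \<Rightarrow> 'f \<Rightarrow> 'f set" where
  "table_star T \<kappa> \<mu> = \<Union>{S. (\<kappa>, \<mu>, S) \<in> T \<or> (\<mu>, \<kappa>, S) \<in> T}"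

text \<open>
  The table prescribes a map on pairs of eigenvalues exactly when the five eigenvalues are
  pairwise distinct, and \<open>table_star\<close> is then this map.
\<close>

lemma realizes_coset_table:
  fixes p q :: "'f::field"
  assumes "distinct (coset_eigenvalues p q)"
  shows "realizes_table (coset_table p q) (table_star (coset_table p q))"
proof -
  obtain u v where uv: "u = 1 - q" "v = p - q" by blast
  have d: "u \<noteq> 0" "u \<noteq> 1" "v \<noteq> 0" "v \<noteq> 1" "p \<noteq> 0" "p \<noteq> 1" "p \<noteq> u" "p \<noteq> v" "u \<noteq> v"
    using assms unfolding coset_eigenvalues_def uv by auto
  note d' = d d[symmetric]
  show ?thesis
    unfolding realizes_table_def table_star_def coset_table_def uv[symmetric]
    by (simp add: d' Collect_disj_eq)
qed

lemma coset_table_well_defined_iff: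
  fixes p q :: "'f::field"
  shows "(\<exists>star. realizes_table (coset_table p q) star) \<longleftrightarrow> distinct (coset_eigenvalues p q)"
proof
  assume "\<exists>star. realizes_table (coset_table p q) star"
  then obtain star where s: "realizes_table (coset_table p q) star" ..
  obtain u v where uv: "u = 1 - q" "v = p - q" by blast
  have t: "star 0 1 = {}" "star 0 p = {p}" "star 0 u = {u}" "star 0 v = {v}"
      "star 1 0 = {}" "star 1 p = {p}" "star 1 u = {u}" "star 1 v = {v}"
      "star p p = {1, 0, p}" "star p u = {v}"
    using s unfolding realizes_table_def coset_table_def uv[symmetric] by simp_all
  have "p \<noteq> 1" "u \<noteq> 1" "v \<noteq> 1" "p \<noteq> 0" "u \<noteq> 0" "v \<noteq> 0"
    using t by auto
  moreover from this have "q \<noteq> 0" "v \<noteq> p" "u \<noteq> v"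
    using uv by auto
  moreover have "p \<noteq> u"
    using t \<open>v \<noteq> 1\<close> by auto
  ultimately show "distinct (coset_eigenvalues p q)"
    unfolding coset_eigenvalues_def uv[symmetric] by auto
next
  assume "distinct (coset_eigenvalues p q)"
  then show "\<exists>star. realizes_table (coset_table p q) star"
    using realizes_coset_table by blast
qed


section \<open>The identity elements in closed form\<close>

lemma sum_fun_apply: "(\<Sum>i\<in>I. f i) x = (\<Sum>i\<in>I. f i x)"
  for f :: "'i \<Rightarrow> 'b \<Rightarrow> 'c::comm_monoid_add"
  by (induction I rule: infinite_finite_induct) auto

lemma finite_transps [simp]: "finite (transps n)"
proof -
  have "transps n \<subseteq> (\<lambda>(a, b). transpose a b) ` ({1..n} \<times> {1..n})"
    unfolding transps_def by auto
  then show ?thesis by (rule finite_subset) auto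
qed

lemma transps_Int_Sym: "i \<le> n \<Longrightarrow> transps n \<inter> Sym i = transps i"
proof (intro equalityI subsetI)
  fix d assume i: "i \<le> n" and "d \<in> transps n \<inter> Sym i"
  then obtain a b where d: "d = transpose a b" "a \<noteq> b" and p: "d permutes {1..i}"
    by (auto simp: transps_def Sym_def)
  have "d a \<noteq> a" "d b \<noteq> b" using d by auto
  then have "a \<in> {1..i}" "b \<in> {1..i}" using p by (auto simp: permutes_def)
  with d show "d \<in> transps i" unfolding transps_def by blast
next
  fix d assume i: "i \<le> n" and "d \<in> transps i"
  then obtain a b where d: "d = transpose a b" "a \<noteq> b" "a \<in> {1..i}" "b \<in> {1..i}"
    unfolding transps_def by blast
  moreover have "a \<in> {1..n}" "b \<in> {1..n}" using d i by auto
  ultimately show "d \<in> transps n \<inter> Sym i"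
    unfolding transps_def Sym_def using permutes_swap_id[of a "{1..i}" b] by blast
qed

lemma inv_transp: "d \<in> transps n \<Longrightarrow> inv d = d"
  by (auto simp: transps_def)

lemma transp_invol: "d \<in> transps n \<Longrightarrow> d (d x) = x"
  by (auto simp: transps_def)

lemma conj_by_transps:
  assumes "c \<in> transps n" "d \<in> transps n"
  shows "conj_by c d \<in> transps n"
proof -
  obtain a b where c: "c = transpose a b" "a \<in> {1..n}" "b \<in> {1..n}" "a \<noteq> b"
    using assms(1) unfolding transps_def by blast
  have p: "d permutes {1..n}"
    using transps_Int_Sym[of n n] assms(2) by (auto simp: Sym_def)
  have "conj_by c d = transpose (d a) (d b)"
  proof
    fix x
    have "d x = a \<longleftrightarrow> x = d a" "d x = b \<longleftrightarrow> x = d b"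
      using transp_invol[OF assms(2)] by metis+
    then show "conj_by c d x = transpose (d a) (d b) x"
      using transp_invol[OF assms(2)]
      by (auto simp: conj_by_def inv_transp[OF assms(2)] c transpose_def)
  qed
  moreover have "d a \<in> {1..n}" "d b \<in> {1..n}" using p c permutes_in_image by metis+
  moreover have "d a \<noteq> d b" using p c permutes_inj by (metis injD)
  ultimately show ?thesis unfolding transps_def by blast
qed

lemma basis_prod_in_alg:
  "c \<in> transps i \<Longrightarrow> d \<in> transps i \<Longrightarrow> basis_prod \<alpha> c d \<in> alg (transps i)"
  using conj_by_transps[of c i d]
  by (auto simp: basis_prod_def alg_def rho_def scl_def)

lemma transps_mono: "i \<le> n \<Longrightarrow> transps i \<subseteq> transps n"
  using transps_Int_Sym by blast

lemma sym_subalg_subset: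
  assumes "i \<le> n"
  shows "sym_subalg n \<alpha> i \<subseteq> alg (transps i)"
proof
  fix x assume "x \<in> sym_subalg n \<alpha> i"
  then show "x \<in> alg (transps i)"
    unfolding sym_subalg_def transps_Int_Sym[OF assms]
  proof (induction rule: subalg.induct)
    case (mult a b)
    have *: "a c * b d * basis_prod \<alpha> c d e = 0" if "e \<notin> transps i" for c d e
      using mult.IH that basis_prod_in_alg[of c i d \<alpha>]
      by (cases "c \<in> transps i"; cases "d \<in> transps i") (auto simp: alg_def)
    show ?case
      by (auto simp: alg_def mprod_def sum_fun_apply scl_def * intro!: sum.neutral)
  qed (auto simp: alg_def rho_def scl_def)
qed

lemma alg_expand:
  assumes "finite D" "b \<in> alg D"
  shows "b = (\<Sum>d\<in>D. scl (b d) (rho d))"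
proof
  fix e
  show "b e = (\<Sum>d\<in>D. scl (b d) (rho d)) e"
    using assms by (cases "e \<in> D")
      (auto simp: sum_fun_apply scl_def rho_def alg_def if_distrib cong: if_cong)
qed

lemma alg_subset_sym_subalg:
  assumes "i \<le> n"
  shows "alg (transps i) \<subseteq> sym_subalg n \<alpha> i"
proof
  fix b :: "perm \<Rightarrow> 'a" assume b: "b \<in> alg (transps i)"
  have "(\<Sum>d\<in>T. scl (b d) (rho d)) \<in> sym_subalg n \<alpha> i" if "finite T" "T \<subseteq> transps i" for T
    using that
  proof (induction T)
    case empty
    show ?case unfolding sym_subalg_def sum.empty by (rule subalg.zero)
  next
    case (insert d T)
    then have "scl (b d) (rho d) \<in> sym_subalg n \<alpha> i"
      unfolding sym_subalg_def transps_Int_Sym[OF assms] by (auto intro: subalg.intros)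
    moreover have "(\<Sum>d\<in>T. scl (b d) (rho d)) \<in> sym_subalg n \<alpha> i"
      using insert by simp
    ultimately show ?case
      unfolding sym_subalg_def sum.insert[OF insert.hyps] by (rule subalg.add)
  qed
  then show "b \<in> sym_subalg n \<alpha> i"
    using alg_expand[OF _ b] by (metis finite_transps order_refl)
qed

lemma sym_subalg_eq: "i \<le> n \<Longrightarrow> sym_subalg n \<alpha> i = alg (transps i)"
  using sym_subalg_subset alg_subset_sym_subalg by blast

lemma noncommuting_transps:
  assumes "a \<noteq> b"
  shows "transpose x y \<circ> transpose a b \<noteq> transpose a b \<circ> transpose x y \<and> x \<noteq> y
    \<longleftrightarrow> x \<noteq> y \<and> transpose x y \<noteq> transpose a b \<and> (x \<in> {a, b} \<or> y \<in> {a, b})"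
    (is "?L \<longleftrightarrow> ?R")
proof
  assume ?L
  then show ?R by (auto simp: fun_eq_iff transpose_def split: if_splits)
next
  assume R: ?R
  have "transpose x y (transpose a b a) \<noteq> transpose a b (transpose x y a)
      \<or> transpose x y (transpose a b b) \<noteq> transpose a b (transpose x y b)"
    using R assms by (auto simp: transpose_def transpose_commute fun_eq_iff split: if_splits)
  then show ?L using R by (metis comp_apply)
qed

lemma transp_braid:
  assumes "c \<in> transps n" "d \<in> transps n" "c \<noteq> d" "c \<circ> d \<noteq> d \<circ> c"
  shows "conj_by c d = conj_by d c"
proof -
  obtain a b where d: "d = transpose a b" "a \<noteq> b"
    using assms(2) unfolding transps_def by blast
  obtain x y where c: "c = transpose x y" "x \<noteq> y"
    using assms(1) unfolding transps_def by blast
  have "x \<in> {a, b} \<or> y \<in> {a, b}"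
    using noncommuting_transps[OF d(2), of x y] assms(3,4) c d by blast
  then show ?thesis
    unfolding conj_by_def inv_transp[OF assms(1)] inv_transp[OF assms(2)]
    using c d assms(3) by (auto simp: fun_eq_iff transpose_def)
qed

lemma basis_prod_commute:
  assumes "c \<in> transps n" "d \<in> transps n"
  shows "basis_prod \<alpha> c d = basis_prod \<alpha> d c"
  using transp_braid[OF assms] unfolding basis_prod_def
  by (auto simp: scl_def add.commute)

lemma mprod_commute: "mprod \<alpha> (transps n) a b = mprod \<alpha> (transps n) b a"
proof -
  have "mprod \<alpha> (transps n) a b
      = (\<Sum>c\<in>transps n. \<Sum>d\<in>transps n. scl (b d * a c) (basis_prod \<alpha> d c))"
    unfolding mprod_def by (intro sum.cong refl) (simp add: mult.commute basis_prod_commute)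
  also have "\<dots> = mprod \<alpha> (transps n) b a"
    unfolding mprod_def by (rule sum.swap)
  finally show ?thesis .
qed

lemma card_noncommuting:
  assumes "d \<in> transps i"
  shows "card {c \<in> transps i. c \<noteq> d \<and> c \<circ> d \<noteq> d \<circ> c} = 2 * (i - 2)" and "2 \<le> i"
proof -
  obtain a b where d: "d = transpose a b" "a \<in> {1..i}" "b \<in> {1..i}" "a \<noteq> b"
    using assms unfolding transps_def by blast
  have "{a, b} \<subseteq> {1..i}" using d by auto
  then have "card {a, b} \<le> card {1..i}" by (intro card_mono) auto
  then show "2 \<le> i" using d by simp
  define K where "K = {1..i} - {a, b}"
  have K: "card K = i - 2"
    unfolding K_def using \<open>{a, b} \<subseteq> {1..i}\<close> d(4) by (subst card_Diff_subset) auto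
  have "{c \<in> transps i. c \<noteq> d \<and> c \<circ> d \<noteq> d \<circ> c} = transpose a ` K \<union> transpose b ` K"
    (is "?N = ?U")
  proof (intro equalityI subsetI)
    fix c assume "c \<in> ?N"
    then obtain x y where c: "c = transpose x y" "x \<in> {1..i}" "y \<in> {1..i}" "x \<noteq> y"
        "c \<noteq> d" "c \<circ> d \<noteq> d \<circ> c"
      unfolding transps_def by blast
    then have "x \<in> {a, b} \<or> y \<in> {a, b}"
      using noncommuting_transps[OF d(4), of x y] d by blast
    then have "(x \<in> {a, b} \<and> y \<in> K) \<or> (y \<in> {a, b} \<and> x \<in> K)"
      using c d by (auto simp: K_def transpose_commute)
    then show "c \<in> ?U"
      using c by (auto simp: transpose_commute)
  next
    fix c assume "c \<in> ?U"
    then obtain z k where c: "c = transpose z k" "k \<in> K" "z = a \<or> z = b" by blast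
    have k: "k \<noteq> a" "k \<noteq> b" "k \<in> {1..i}" "z \<noteq> k" "z \<in> {1..i}" using c d by (auto simp: K_def)
    have "c k \<noteq> d k" using k c d by (auto simp: transpose_def)
    then have ne: "c \<noteq> d" by blast
    then have "c \<circ> d \<noteq> d \<circ> c"
      using noncommuting_transps[OF d(4), of z k] c d k by blast
    moreover have "c \<in> transps i" unfolding transps_def using c k by blast
    ultimately show "c \<in> ?N" using ne by blast
  qed
  moreover have "inj_on (transpose a) K" "inj_on (transpose b) K"
    by (auto intro!: inj_onI simp: K_def) (metis transpose_apply_first)+
  moreover have "transpose a ` K \<inter> transpose b ` K = {}"
  proof -
    have "transpose a k a \<noteq> transpose b k' a" if "k \<in> K" "k' \<in> K" for k k'
      using that d by (auto simp: K_def transpose_def)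
    then show ?thesis by (metis (no_types, lifting) disjoint_iff imageE)
  qed
  ultimately show "card ?N = 2 * (i - 2)"
    using K by (simp add: card_Un_disjoint card_image K_def)
qed

lemma sum_basis_prod:
  fixes \<alpha> :: "'f::field"
  assumes two: "(2::'f) \<noteq> 0" and d: "d \<in> transps i"
  shows "(\<Sum>c\<in>transps i. basis_prod \<alpha> c d) = scl (1 + \<alpha> * (of_nat i - 2)) (rho d)"
proof -
  define N where "N = {c \<in> transps i. c \<noteq> d \<and> c \<circ> d \<noteq> d \<circ> c}"
  have N: "N \<subseteq> transps i" "finite N" "d \<notin> N" unfolding N_def by auto
  have conjN: "conj_by c d \<in> N" "conj_by (conj_by c d) d = c" if c: "c \<in> N" for c
  proof -
    show 2: "conj_by (conj_by c d) d = c"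
      by (simp add: conj_by_def inv_transp[OF d] fun_eq_iff transp_invol[OF d])
    have "conj_by c d \<noteq> d"
    proof
      assume e: "conj_by c d = d"
      have "c = conj_by d d" using 2 e by simp
      also have "\<dots> = d"
        by (simp add: conj_by_def inv_transp[OF d] fun_eq_iff transp_invol[OF d])
      finally show False using c by (simp add: N_def)
    qed
    moreover have "conj_by c d \<circ> d \<noteq> d \<circ> conj_by c d"
    proof
      assume "conj_by c d \<circ> d = d \<circ> conj_by c d"
      then have "d \<circ> c = c \<circ> d"
        by (simp add: conj_by_def inv_transp[OF d] fun_eq_iff transp_invol[OF d])
      then show False using c by (simp add: N_def)
    qed
    ultimately show "conj_by c d \<in> N"
      using c conj_by_transps[OF _ d] by (auto simp: N_def)
  qed
  have bij: "bij_betw (\<lambda>c. conj_by c d) N N"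
    by (rule bij_betw_byWitness[where f' = "\<lambda>c. conj_by c d"]) (auto simp: conjN)
  have reindex: "(\<Sum>c\<in>N. rho (conj_by c d) e :: 'f) = (\<Sum>c\<in>N. rho c e)" for e
    using sum.reindex_bij_betw[OF bij, of "\<lambda>c. rho c e"] by simp
  have "(\<Sum>c\<in>transps i. basis_prod \<alpha> c d) e = scl (1 + \<alpha> * (of_nat i - 2)) (rho d) e" for e
  proof -
    have "(\<Sum>c\<in>transps i. basis_prod \<alpha> c d) e = (\<Sum>c\<in>transps i. basis_prod \<alpha> c d e)"
      by (rule sum_fun_apply)
    also have "\<dots> = (\<Sum>c\<in>insert d N. basis_prod \<alpha> c d e)"
      by (rule sum.mono_neutral_right) (use N d in \<open>auto simp: N_def basis_prod_def\<close>)
    also have "\<dots> = rho d e + (\<Sum>c\<in>N. basis_prod \<alpha> c d e)"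
      using N by (simp add: basis_prod_def)
    also have "(\<Sum>c\<in>N. basis_prod \<alpha> c d e)
        = (\<Sum>c\<in>N. \<alpha> / 2 * (rho c e + rho d e - rho (conj_by c d) e))"
      by (intro sum.cong) (auto simp: N_def basis_prod_def scl_def)
    also have "\<dots> = \<alpha> / 2 * (of_nat (card N) * rho d e)"
      unfolding sum_distrib_left[symmetric] sum_subtractf sum.distrib reindex by simp
    also have "of_nat (card N) = (2 :: 'f) * (of_nat i - 2)"
      using card_noncommuting[OF d] by (simp add: N_def of_nat_diff)
    also have "\<alpha> / 2 * (2 * (of_nat i - 2) * rho d e) = \<alpha> * (of_nat i - 2) * rho d e"
      using two by simp
    finally show ?thesis by (simp add: scl_def distrib_right)
  qed
  then show ?thesis by blast
qed

lemma mprod_sum_rho: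
  fixes \<alpha> :: "'f::field"
  assumes two: "(2::'f) \<noteq> 0" and i: "i \<le> n" and b: "b \<in> alg (transps i)"
  shows "mprod \<alpha> (transps n) (scl r (\<Sum>c\<in>transps i. rho c)) b
       = scl (r * (1 + \<alpha> * (of_nat i - 2))) b"
proof
  fix e
  have S: "scl r (\<Sum>c\<in>transps i. rho c) c = (if c \<in> transps i then r else 0)" for c
    by (simp add: scl_def sum_fun_apply rho_def)
  have b0: "b d = 0" if "d \<notin> transps i" for d using b that by (simp add: alg_def)
  have "mprod \<alpha> (transps n) (scl r (\<Sum>c\<in>transps i. rho c)) b e
      = (\<Sum>c\<in>transps n. \<Sum>d\<in>transps n. (if c \<in> transps i then r else 0) * b d * basis_prod \<alpha> c d e)"
    unfolding mprod_def S by (simp add: sum_fun_apply scl_def)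
  also have "\<dots> = (\<Sum>c\<in>transps i. \<Sum>d\<in>transps n. r * b d * basis_prod \<alpha> c d e)"
    by (rule sum.mono_neutral_cong_right) (use transps_mono[OF i] in auto)
  also have "\<dots> = (\<Sum>c\<in>transps i. \<Sum>d\<in>transps i. r * b d * basis_prod \<alpha> c d e)"
    by (intro sum.cong refl sum.mono_neutral_right) (use transps_mono[OF i] b0 in auto)
  also have "\<dots> = (\<Sum>d\<in>transps i. r * b d * (\<Sum>c\<in>transps i. basis_prod \<alpha> c d) e)"
    by (subst sum.swap) (simp add: sum_distrib_left sum_fun_apply)
  also have "\<dots> = (\<Sum>d\<in>transps i. r * (1 + \<alpha> * (of_nat i - 2)) * scl (b d) (rho d) e)"
    by (intro sum.cong refl) (simp add: sum_basis_prod[OF two] scl_def mult_ac)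
  also have "\<dots> = scl (r * (1 + \<alpha> * (of_nat i - 2))) (\<Sum>d\<in>transps i. scl (b d) (rho d)) e"
    by (simp add: scl_def sum_fun_apply sum_distrib_left)
  also have "\<dots> = scl (r * (1 + \<alpha> * (of_nat i - 2))) b e"
    using alg_expand[OF _ b] by simp
  finally show "mprod \<alpha> (transps n) (scl r (\<Sum>c\<in>transps i. rho c)) b e
      = scl (r * (1 + \<alpha> * (of_nat i - 2))) b e" .
qed

lemma is_identity_unique:
  "is_identity \<alpha> D B e \<Longrightarrow> is_identity \<alpha> D B e' \<Longrightarrow> e = e'"
  unfolding is_identity_def by metis

lemma sum_rho_in_alg: "scl r (\<Sum>c\<in>transps i. rho c) \<in> alg (transps i)"
  by (simp add: alg_def scl_def sum_fun_apply rho_def)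

lemma is_identity_closed_form:
  fixes \<alpha> :: "'f::field"
  assumes "(2::'f) \<noteq> 0" "i \<le> n" "1 + \<alpha> * (of_nat i - 2) \<noteq> 0"
  shows "is_identity \<alpha> (transps n) (sym_subalg n \<alpha> i)
           (scl (1 / (1 + \<alpha> * (of_nat i - 2))) (\<Sum>d\<in>transps n \<inter> Sym i. rho d))"
proof -
  have "mprod \<alpha> (transps n) (scl (1 / (1 + \<alpha> * (of_nat i - 2))) (\<Sum>d\<in>transps i. rho d)) b = b"
    if "b \<in> alg (transps i)" for b
    using mprod_sum_rho[OF assms(1,2) that, of \<alpha> "1 / (1 + \<alpha> * (of_nat i - 2))"] assms(3)
    by (simp add: scl_def)
  then show ?thesis
    unfolding is_identity_def sym_subalg_eq[OF assms(2)] transps_Int_Sym[OF assms(2)]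
    using sum_rho_in_alg by (metis mprod_commute)
qed

lemma id_elt_closed_form:
  fixes \<alpha> :: "'f::field"
  assumes "(2::'f) \<noteq> 0" "i \<le> n" "1 + \<alpha> * (of_nat i - 2) \<noteq> 0"
  shows "id_elt n \<alpha> i = scl (1 / (1 + \<alpha> * (of_nat i - 2))) (\<Sum>d\<in>transps n \<inter> Sym i. rho d)"
  unfolding id_elt_def
  using is_identity_closed_form[OF assms] is_identity_unique by blast

text \<open>
  For \<open>i = 0\<close> the subalgebra is zero and has an identity although \<open>1 - 2 * \<alpha>\<close> may vanish.
\<close>

lemma admits_id_iff:
  fixes \<alpha> :: "'f::field"
  assumes "(2::'f) \<noteq> 0" "\<alpha> \<noteq> 1" "1 \<le> i" "i \<le> n"
  shows "admits_id n \<alpha> i \<longleftrightarrow> 1 + \<alpha> * (of_nat i - 2) \<noteq> 0"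
proof
  assume "admits_id n \<alpha> i"
  then obtain e where e: "is_identity \<alpha> (transps n) (alg (transps i)) e"
    unfolding admits_id_def sym_subalg_eq[OF assms(4)] by blast
  show "1 + \<alpha> * (of_nat i - 2) \<noteq> 0"
  proof
    assume z: "1 + \<alpha> * (of_nat i - 2) = 0"
    show False
    proof (cases "i = 1")
      case True
      then show False using z assms(2) by simp
    next
      case False
      have "transpose 1 2 \<in> transps i" (is "?t \<in> _")
        unfolding transps_def using False assms(3) by force
      let ?S = "scl 1 (\<Sum>c\<in>transps i. rho c) :: perm \<Rightarrow> 'f"
      have "mprod \<alpha> (transps n) ?S e = ?S"
        using e sum_rho_in_alg unfolding is_identity_def by blast
      moreover have "mprod \<alpha> (transps n) ?S e = scl (1 * (1 + \<alpha> * (of_nat i - 2))) e"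
        using e by (intro mprod_sum_rho assms(1,4)) (simp add: is_identity_def)
      ultimately have "?S ?t = 0" using z by (simp add: scl_def)
      then show False
        using \<open>?t \<in> transps i\<close> by (simp add: scl_def sum_fun_apply rho_def)
    qed
  qed
next
  assume "1 + \<alpha> * (of_nat i - 2) \<noteq> 0"
  then show "admits_id n \<alpha> i"
    unfolding admits_id_def using is_identity_closed_form[OF assms(1,4)] by blast
qed

end

theory Submission
  imports Defs
begin

text \<open>
  The idea is to reduce the five-eigenvalue fusion rules of \<open>e - f\<close>, where \<open>e\<close> and \<open>f\<close> are the
  identities for \<open>m\<close> and \<open>l\<close>, to three-eigenvalue rules for \<open>e\<close> and \<open>f\<close> separately.

  For a transposition \<open>d\<close>, multiplication by \<open>d\<close> commutes with multiplication by every vector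
  annihilated by \<open>d\<close>. Since \<open>e - d\<close> is such a vector for each \<open>d\<close> in \<open>Sym m\<close>, multiplication by
  \<open>e\<close> commutes with multiplication by the subalgebra of \<open>Sym m\<close>, which is the 1-eigenspace of \<open>e\<close>;
  and the 0-eigenspace of \<open>e\<close> consists of the vectors annihilated by all these \<open>d\<close>. Hence \<open>e\<close> has
  the eigenvalues \<open>1\<close>, \<open>0\<close>, \<open>eta \<alpha> m\<close>, and its 1- and 0-eigenspaces preserve every eigenspace
  of \<open>e\<close>.

  As \<open>f\<close> lies in the 1-eigenspace of \<open>e\<close>, the two multiplications commute and the algebra splits
  into joint eigenspaces. Writing \<open>p\<close> and \<open>q\<close> for the third eigenvalues of \<open>e\<close> and \<open>f\<close>, only the
  pairs \<open>(1, 0)\<close>, \<open>(1, 1)\<close>, \<open>(0, 0)\<close>, \<open>(p, 0)\<close>, \<open>(1, q)\<close>, \<open>(p, q)\<close> occur, and the fusion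
  table is read off from the rules for \<open>e\<close> and \<open>f\<close> on these pairs.
\<close>

section \<open>Linear structure and products of transpositions\<close>

lemmas fun_ops = plus_fun_apply minus_apply zero_fun_apply scl_def sum_fun_apply

lemma alg_closed:
  "0 \<in> alg D"
  "a \<in> alg D \<Longrightarrow> b \<in> alg D \<Longrightarrow> a + b \<in> alg D"
  "a \<in> alg D \<Longrightarrow> b \<in> alg D \<Longrightarrow> a - b \<in> alg D"
  "a \<in> alg D \<Longrightarrow> scl r a \<in> alg D"
  by (auto simp: alg_def scl_def)

lemma alg_sum: "(\<And>i. i \<in> I \<Longrightarrow> f i \<in> alg D) \<Longrightarrow> sum f I \<in> alg D"
  by (induction I rule: infinite_finite_induct) (auto simp: alg_closed)

lemma rho_in_alg: "d \<in> D \<Longrightarrow> rho d \<in> alg D"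
  by (auto simp: alg_def rho_def)

lemma alg_mono: "D \<subseteq> D' \<Longrightarrow> alg D \<subseteq> alg D'"
  by (auto simp: alg_def)

lemma alg_induct [consumes 2, case_names zero add scale basis]:
  assumes "finite D" "b \<in> alg D"
    and zero: "P 0"
    and add: "\<And>a b. a \<in> alg D \<Longrightarrow> b \<in> alg D \<Longrightarrow> P a \<Longrightarrow> P b \<Longrightarrow> P (a + b)"
    and scale: "\<And>r a. a \<in> alg D \<Longrightarrow> P a \<Longrightarrow> P (scl r a)"
    and basis: "\<And>d. d \<in> D \<Longrightarrow> P (rho d)"
  shows "P b"
proof -
  have "(\<Sum>d\<in>T. scl (b d) (rho d)) \<in> alg D \<and> P (\<Sum>d\<in>T. scl (b d) (rho d))"
    if "finite T" "T \<subseteq> D" for T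
    using that
  proof (induction T)
    case empty
    show ?case unfolding sum.empty using zero alg_closed(1) by blast
  next
    case (insert d T)
    then have "scl (b d) (rho d) \<in> alg D" "P (scl (b d) (rho d))"
      using scale basis by (auto simp: alg_closed rho_in_alg)
    with insert show ?case
      unfolding sum.insert[OF insert.hyps] using add alg_closed(2) by blast
  qed
  then show ?thesis using alg_expand[OF assms(1,2)] assms(1) by (metis order_refl)
qed

lemma mprod_add_left: "mprod \<alpha> D (a + b) c = mprod \<alpha> D a c + mprod \<alpha> D b c"
  and mprod_add_right: "mprod \<alpha> D c (a + b) = mprod \<alpha> D c a + mprod \<alpha> D c b"
  and mprod_diff_left: "mprod \<alpha> D (a - b) c = mprod \<alpha> D a c - mprod \<alpha> D b c"
  and mprod_diff_right: "mprod \<alpha> D c (a - b) = mprod \<alpha> D c a - mprod \<alpha> D c b"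
  and mprod_scl_left: "mprod \<alpha> D (scl r a) c = scl r (mprod \<alpha> D a c)"
  and mprod_scl_right: "mprod \<alpha> D c (scl r a) = scl r (mprod \<alpha> D c a)"
  and mprod_zero_left: "mprod \<alpha> D 0 c = 0"
  and mprod_zero_right: "mprod \<alpha> D c 0 = 0"
  by (auto simp: fun_eq_iff mprod_def fun_ops algebra_simps sum.distrib sum_subtractf sum_distrib_left)

lemmas mprod_linear = mprod_add_left mprod_add_right mprod_diff_left mprod_diff_right
  mprod_scl_left mprod_scl_right mprod_zero_left mprod_zero_right

lemma mprod_sum_left: "mprod \<alpha> D (\<Sum>i\<in>I. f i) c = (\<Sum>i\<in>I. mprod \<alpha> D (f i) c)"
  using sum_comp_morphism[of "\<lambda>a. mprod \<alpha> D a c" f I] by (simp only: mprod_linear o_def)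

lemma mprod_sum_right: "mprod \<alpha> D c (\<Sum>i\<in>I. f i) = (\<Sum>i\<in>I. mprod \<alpha> D c (f i))"
  using sum_comp_morphism[of "mprod \<alpha> D c" f I] by (simp only: mprod_linear o_def)

section \<open>Products of two basis vectors\<close>

lemma mprod_rho:
  assumes "finite D" "c \<in> D" "d \<in> D"
  shows "mprod \<alpha> D (rho c) (rho d) = basis_prod \<alpha> c d"
proof
  fix e
  have "mprod \<alpha> D (rho c) (rho d) e
      = (\<Sum>x\<in>D. if x = c then \<Sum>y\<in>D. if y = d then basis_prod \<alpha> x y e else 0 else 0)"
    unfolding mprod_def fun_ops rho_def by (intro sum.cong refl) (auto intro!: sum.cong)
  then show "mprod \<alpha> D (rho c) (rho d) e = basis_prod \<alpha> c d e"
    using assms by simp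
qed

lemma mprod_in_alg:
  assumes "i \<le> n" "a \<in> alg (transps i)" "b \<in> alg (transps i)"
  shows "mprod \<alpha> (transps n) a b \<in> alg (transps i)"
  using subalg.mult[of a \<alpha> "transps n" _ b] assms
  unfolding sym_subalg_eq[OF assms(1), symmetric, of \<alpha>] sym_subalg_def by blast

text \<open>Basis vectors are indexed by the two moved points, as edges of the complete graph on
  \<open>{1..n}\<close>. A product is then governed by whether two edges coincide, are disjoint or
  share one point.\<close>

definition edge :: "nat \<Rightarrow> nat \<Rightarrow> perm \<Rightarrow> 'f::field" where
  "edge i j = rho (transpose i j)"

lemma edge_commute: "edge i j = edge j i"
  by (simp add: edge_def transpose_commute)

lemma transps_cases:
  assumes "d \<in> transps i"
  obtains a b where "d = transpose a b" "a \<in> {1..i}" "b \<in> {1..i}" "a \<noteq> b"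
  using assms unfolding transps_def by blast

lemma transpose_in_transps:
  "a \<in> {1..i} \<Longrightarrow> b \<in> {1..i} \<Longrightarrow> a \<noteq> b \<Longrightarrow> transpose a b \<in> transps i"
  unfolding transps_def by blast

lemma edge_in_alg:
  "a \<in> {1..i} \<Longrightarrow> b \<in> {1..i} \<Longrightarrow> a \<noteq> b \<Longrightarrow> edge a b \<in> alg (transps i)"
  unfolding edge_def by (rule rho_in_alg[OF transpose_in_transps])

lemma edge_idem:
  assumes "i \<in> {1..n}" "j \<in> {1..n}" "i \<noteq> j"
  shows "mprod \<alpha> (transps n) (edge i j) (edge i j) = edge i j"
  using assms by (simp add: edge_def mprod_rho transpose_in_transps basis_prod_def)

lemma edge_disjoint:
  assumes "{i, j, k, l} \<subseteq> {1..n}" "i \<noteq> j" "k \<noteq> l" "{i, j} \<inter> {k, l} = {}"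
  shows "mprod \<alpha> (transps n) (edge i j) (edge k l) = 0"
proof -
  have "transpose i j k \<noteq> transpose k l k" using assms by (auto simp: transpose_def)
  then have "transpose i j \<noteq> transpose k l" by metis
  moreover have "transpose i j \<circ> transpose k l = transpose k l \<circ> transpose i j"
    using assms by (auto simp: fun_eq_iff transpose_def)
  ultimately show ?thesis
    using assms by (simp add: edge_def mprod_rho transpose_in_transps basis_prod_def)
qed

lemma edge_adjacent:
  assumes "{i, j, k} \<subseteq> {1..n}" "i \<noteq> j" "i \<noteq> k" "j \<noteq> k"
  shows "mprod \<alpha> (transps n) (edge i j) (edge i k)
    = scl (\<alpha> / 2) (edge i j + edge i k - edge j k)"
proof -
  have "transpose i j i \<noteq> transpose i k i" using assms by (auto simp: transpose_def)
  then have "transpose i j \<noteq> transpose i k" by metis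
  moreover have "(transpose i j \<circ> transpose i k) i \<noteq> (transpose i k \<circ> transpose i j) i"
    using assms by (auto simp: transpose_def)
  then have "transpose i j \<circ> transpose i k \<noteq> transpose i k \<circ> transpose i j" by metis
  moreover have "conj_by (transpose i j) (transpose i k) = transpose j k"
    using assms by (auto simp: conj_by_def fun_eq_iff transpose_def)
  ultimately show ?thesis
    using assms by (simp add: edge_def mprod_rho transpose_in_transps basis_prod_def)
qed

declare fun_ops [simp del]

(* The index inequalities below would otherwise be case-split by linear arithmetic. *)
declare [[linarith_neq_limit = 0]]

lemma mprod_range: "mprod \<alpha> (transps n) a b \<in> alg (transps n)"
  using basis_prod_in_alg[of _ n _ \<alpha>]
  by (auto simp: alg_def mprod_def fun_ops intro!: sum.neutral)

text \<open>Only products with a 1- or 0-eigenvector are constrained, not those of two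
  \<eta>-eigenvectors: every restrictive entry of the coset table comes from a factor with
  eigenvalue 1 or 0 for one of the two axes. Leaving \<kappa> arbitrary in \<open>mult_1\<close> and
  \<open>mult_0\<close> avoids a case split over the three eigenvalues.\<close>

locale peirce_axis =
  fixes \<alpha> :: "'f::field" and n :: nat and e :: "perm \<Rightarrow> 'f" and \<eta> :: 'f
  assumes axis_in_alg: "e \<in> alg (transps n)"
    and axis_idem: "mprod \<alpha> (transps n) e e = e"
    and non_degenerate: "\<eta> \<noteq> 0" "\<eta> \<noteq> 1"
    and decomp: "b \<in> alg (transps n) \<Longrightarrow>
      \<exists>b1\<in>eigenspace \<alpha> (transps n) e 1. \<exists>b0\<in>eigenspace \<alpha> (transps n) e 0.
      \<exists>b2\<in>eigenspace \<alpha> (transps n) e \<eta>. b = b1 + b0 + b2"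
    and mult_1: "a \<in> eigenspace \<alpha> (transps n) e 1 \<Longrightarrow> b \<in> eigenspace \<alpha> (transps n) e \<kappa> \<Longrightarrow>
      mprod \<alpha> (transps n) a b \<in> eigenspace \<alpha> (transps n) e \<kappa>"
    and mult_0: "a \<in> eigenspace \<alpha> (transps n) e 0 \<Longrightarrow> b \<in> eigenspace \<alpha> (transps n) e \<kappa> \<Longrightarrow>
      mprod \<alpha> (transps n) a b \<in> eigenspace \<alpha> (transps n) e \<kappa>"

text \<open>The closed form of the identity in \<open>id_elt_closed_form\<close>, written without
  the ambient \<open>n\<close>.\<close>

definition sym_id :: "'f::field \<Rightarrow> nat \<Rightarrow> perm \<Rightarrow> 'f" where
  "sym_id \<alpha> m = scl (1 / (1 + \<alpha> * (of_nat m - 2))) (\<Sum>d\<in>transps m. rho d)"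

section \<open>Commuting multiplications\<close>

context
  fixes \<alpha> :: "'f::field" and n :: nat
begin

abbreviation mul :: "(perm \<Rightarrow> 'f) \<Rightarrow> (perm \<Rightarrow> 'f) \<Rightarrow> perm \<Rightarrow> 'f" (infixl "\<odot>" 70) where
  "a \<odot> b \<equiv> mprod \<alpha> (transps n) a b"

text \<open>All products of two distinct sides, in both orders and with each side in one fixed
  orientation, so that the six equations serve as a rewriting table.\<close>

lemma triangle:
  assumes "{i, j, k} \<subseteq> {1..n}" "distinct [i, j, k]"
  shows "edge i j \<odot> edge i k = scl (\<alpha> / 2) (edge i j + edge i k - edge j k)"
    "edge i k \<odot> edge i j = scl (\<alpha> / 2) (edge i j + edge i k - edge j k)"
    "edge i j \<odot> edge j k = scl (\<alpha> / 2) (edge i j + edge j k - edge i k)"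
    "edge j k \<odot> edge i j = scl (\<alpha> / 2) (edge i j + edge j k - edge i k)"
    "edge i k \<odot> edge j k = scl (\<alpha> / 2) (edge i k + edge j k - edge i j)"
    "edge j k \<odot> edge i k = scl (\<alpha> / 2) (edge i k + edge j k - edge i j)"
proof -
  have 1: "edge i j \<odot> edge i k = scl (\<alpha> / 2) (edge i j + edge i k - edge j k)"
    "edge j i \<odot> edge j k = scl (\<alpha> / 2) (edge j i + edge j k - edge i k)"
    "edge k i \<odot> edge k j = scl (\<alpha> / 2) (edge k i + edge k j - edge i j)"
    using assms by (auto intro!: edge_adjacent)
  note 2 = 1[unfolded edge_commute[of j i] edge_commute[of k i] edge_commute[of k j]]
  show "edge i j \<odot> edge i k = scl (\<alpha> / 2) (edge i j + edge i k - edge j k)"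
    "edge i j \<odot> edge j k = scl (\<alpha> / 2) (edge i j + edge j k - edge i k)"
    "edge i k \<odot> edge j k = scl (\<alpha> / 2) (edge i k + edge j k - edge i j)"
    using 2 by blast+
  then show "edge i k \<odot> edge i j = scl (\<alpha> / 2) (edge i j + edge i k - edge j k)"
    "edge j k \<odot> edge i j = scl (\<alpha> / 2) (edge i j + edge j k - edge i k)"
    "edge j k \<odot> edge i k = scl (\<alpha> / 2) (edge i k + edge j k - edge i j)"
    using mprod_commute[of \<alpha> n] by metis+
qed

text \<open>Reorients an edge so that a chosen endpoint comes first; cases that differ only in the
  naming of endpoints then merge.\<close>

lemma edge_other:
  assumes "u \<in> {a, b}" "a \<noteq> b"
  obtains v where "v \<in> {a, b}" "u \<noteq> v" "(edge u v :: perm \<Rightarrow> 'f) = edge a b"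
  using assms edge_commute[of a b] by (metis insertCI insertE singletonD)

text \<open>An edge \<open>x y\<close> either misses one of the two disjoint edges or joins them. In
  the first case both sides vanish; in the second the identity is a computation on four
  points.\<close>

lemma edges_commute_disjoint:
  assumes "{a, b, c, d, x, y} \<subseteq> {1..n}" "a \<noteq> b" "c \<noteq> d" "{a, b} \<inter> {c, d} = {}" "x \<noteq> y"
  shows "edge a b \<odot> (edge c d \<odot> edge x y) = edge c d \<odot> (edge a b \<odot> edge x y)"
proof -
  have disj: "edge i j \<odot> (edge k l \<odot> edge x y) = edge k l \<odot> (edge i j \<odot> edge x y)"
    if h: "{i, j, k, l, x, y} \<subseteq> {1..n}" "i \<noteq> j" "k \<noteq> l" "x \<noteq> y"
      "{i, j} \<inter> {k, l} = {}" "{i, j} \<inter> {x, y} = {}" for i j k l x y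
  proof -
    \<comment> \<open>The inner product is a combination of edges among \<open>k\<close>,
      \<open>l\<close>, \<open>z\<close>, all disjoint from \<open>i j\<close>.\<close>
    have *: "edge i j \<odot> (edge k l \<odot> edge k z) = 0"
      if "{i, j, k, l, z} \<subseteq> {1..n}" "i \<noteq> j" "k \<noteq> l" "k \<noteq> z" "{i, j} \<inter> {k, l, z} = {}"
      for i j k l z
    proof (cases "z = l")
      case True
      then show ?thesis using that by (simp add: edge_idem edge_disjoint)
    next
      case False
      then have "edge k l \<odot> edge k z = scl (\<alpha> / 2) (edge k l + edge k z - edge l z)"
        using that by (intro edge_adjacent) auto
      moreover have "edge i j \<odot> edge k l = 0" "edge i j \<odot> edge k z = 0" "edge i j \<odot> edge l z = 0"
        using that False by (auto intro!: edge_disjoint)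
      note p = calculation this
      show ?thesis unfolding p mprod_linear by (simp add: fun_eq_iff fun_ops)
    qed
    have "edge i j \<odot> edge x y = 0" using that by (intro edge_disjoint) auto
    moreover have "edge i j \<odot> (edge k l \<odot> edge x y) = 0"
    proof (cases "{k, l} \<inter> {x, y} = {}")
      case True
      then have "edge k l \<odot> edge x y = 0" using that by (intro edge_disjoint) auto
      then show ?thesis by (simp only: mprod_linear)
    next
      case False
      then obtain u where u: "u \<in> {k, l}" "u \<in> {x, y}" by blast
      obtain v where v: "v \<in> {k, l}" "u \<noteq> v" "(edge u v :: perm \<Rightarrow> 'f) = edge k l"
        using edge_other[OF u(1) h(3)] .
      obtain w where w: "w \<in> {x, y}" "u \<noteq> w" "(edge u w :: perm \<Rightarrow> 'f) = edge x y"
        using edge_other[OF u(2) h(4)] .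
      have "{i, j, u, v, w} \<subseteq> {1..n}" "{i, j} \<inter> {u, v, w} = {}"
        using u v(1) w(1) that(1,5,6) by blast+
      then have "edge i j \<odot> (edge u v \<odot> edge u w) = 0"
        using that(2) v(2) w(2) by (intro *)
      then show ?thesis unfolding v(3) w(3) .
    qed
    ultimately show ?thesis by (simp only: mprod_linear)
  qed
  \<comment> \<open>This is the joining case; all four triangles on \<open>i\<close>,
    \<open>j\<close>, \<open>k\<close>, \<open>l\<close> enter.\<close>
  have 2: "edge i j \<odot> (edge k l \<odot> edge i k) = edge k l \<odot> (edge i j \<odot> edge i k)"
    if "{i, j, k, l} \<subseteq> {1..n}" "distinct [i, j, k, l]" for i j k l
  proof -
    have t: "{i, j, k} \<subseteq> {1..n}" "distinct [i, j, k]" "{i, j, l} \<subseteq> {1..n}" "distinct [i, j, l]"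
      "{i, k, l} \<subseteq> {1..n}" "distinct [i, k, l]" "{j, k, l} \<subseteq> {1..n}" "distinct [j, k, l]"
      using that by auto
    note p = triangle[OF t(1,2)] triangle[OF t(3,4)] triangle[OF t(5,6)] triangle[OF t(7,8)]
    have "edge i j \<odot> edge k l = 0" "edge k l \<odot> edge i j = 0"
      using that by (auto intro!: edge_disjoint)
    note q = this
    show ?thesis unfolding p q mprod_linear by (simp add: fun_eq_iff fun_ops algebra_simps)
  qed
  have cross: "edge a b \<odot> (edge c d \<odot> edge i k) = edge c d \<odot> (edge a b \<odot> edge i k)"
    if h: "i \<in> {a, b}" "k \<in> {c, d}" for i k
  proof -
    obtain j where j: "j \<in> {a, b}" "i \<noteq> j" "(edge i j :: perm \<Rightarrow> 'f) = edge a b"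
      using edge_other[OF h(1) assms(2)] .
    obtain l where l: "l \<in> {c, d}" "k \<noteq> l" "(edge k l :: perm \<Rightarrow> 'f) = edge c d"
      using edge_other[OF h(2) assms(3)] .
    have "{i, j, k, l} \<subseteq> {1..n}" "{i, j} \<inter> {k, l} = {}"
      using that j(1) l(1) assms(1,4) by blast+
    then have "edge i j \<odot> (edge k l \<odot> edge i k) = edge k l \<odot> (edge i j \<odot> edge i k)"
      using j(2) l(2) by (intro 2) auto
    then show ?thesis unfolding j(3) l(3) .
  qed
  consider "{a, b} \<inter> {x, y} = {}" | "{c, d} \<inter> {x, y} = {}"
    | "x \<in> {a, b}" "y \<in> {c, d}" | "y \<in> {a, b}" "x \<in> {c, d}"
    using assms(4) by blast
  then show ?thesis
  proof cases
    case 1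
    with assms show ?thesis by (intro disj)
  next
    case 2
    then have "edge c d \<odot> (edge a b \<odot> edge x y) = edge a b \<odot> (edge c d \<odot> edge x y)"
      by (intro disj) (use assms in auto)
    then show ?thesis ..
  next
    case 3
    then show ?thesis by (rule cross)
  next
    case 4
    then show ?thesis unfolding edge_commute[of x y] by (rule cross)
  qed
qed

text \<open>When \<open>2\<close> is nonzero, \<open>edge a c + edge b c\<close> differs from a
  vector annihilated by \<open>edge a b\<close> by the multiple
  \<open>scl \<alpha> (edge a b)\<close>. Together with the disjoint edges this yields all
  annihilated vectors that are needed. The cases are the ways in which \<open>x y\<close> meets
  \<open>{a, b, c}\<close>.\<close>

lemma edges_commute_adjacent:
  assumes "{a, b, c, x, y} \<subseteq> {1..n}" "distinct [a, b, c]" "x \<noteq> y"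
  shows "edge a b \<odot> ((edge a c + edge b c) \<odot> edge x y)
    = (edge a c + edge b c) \<odot> (edge a b \<odot> edge x y)"
    (is "?P x y")
proof -
  define \<beta> where "\<beta> = \<alpha> / 2"
  note tri = triangle[folded \<beta>_def]
  have 1: "edge i j \<odot> edge i j = edge i j" "edge i k \<odot> edge i k = edge i k"
      "edge j k \<odot> edge j k = edge j k"
    if "{i, j, k} \<subseteq> {1..n}" "distinct [i, j, k]" for i j k
    using that by (auto intro!: edge_idem)
  have ab: "?P a b"
  proof -
    have t: "{a, b, c} \<subseteq> {1..n}" using assms(1) by blast
    show ?thesis
      unfolding 1[OF t assms(2)] tri[OF t assms(2)] mprod_linear
      by (simp add: fun_eq_iff fun_ops algebra_simps)
  qed
  have ac: "edge i j \<odot> ((edge i k + edge j k) \<odot> edge i k)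
      = (edge i k + edge j k) \<odot> (edge i j \<odot> edge i k)"
    if t: "{i, j, k} \<subseteq> {1..n}" "distinct [i, j, k]" for i j k
    unfolding 1[OF t] tri[OF t] mprod_linear
    by (simp add: fun_eq_iff fun_ops algebra_simps)
  have az: "edge i j \<odot> ((edge i k + edge j k) \<odot> edge i z)
      = (edge i k + edge j k) \<odot> (edge i j \<odot> edge i z)"
    if "{i, j, k, z} \<subseteq> {1..n}" "distinct [i, j, k, z]" for i j k z
  proof -
    have t: "{i, j, k} \<subseteq> {1..n}" "distinct [i, j, k]" "{i, j, z} \<subseteq> {1..n}" "distinct [i, j, z]"
      "{i, k, z} \<subseteq> {1..n}" "distinct [i, k, z]" "{j, k, z} \<subseteq> {1..n}" "distinct [j, k, z]"
      using that by auto
    have q: "edge j k \<odot> edge i z = 0" "edge i k \<odot> edge j z = 0" "edge i j \<odot> edge k z = 0"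
      using that by (auto intro!: edge_disjoint)
    show ?thesis
      unfolding tri[OF t(1,2)] tri[OF t(3,4)] tri[OF t(5,6)] tri[OF t(7,8)] q mprod_linear
      by (simp add: fun_eq_iff fun_ops algebra_simps)
  qed
  have cz: "?P c z" if "z \<in> {1..n}" "z \<notin> {a, b, c}" for z
  proof -
    have t: "{a, b, c} \<subseteq> {1..n}" "distinct [a, b, c]" "{a, b, z} \<subseteq> {1..n}" "distinct [a, b, z]"
      "{a, c, z} \<subseteq> {1..n}" "distinct [a, c, z]" "{b, c, z} \<subseteq> {1..n}" "distinct [b, c, z]"
      using that assms by auto
    have q: "edge a b \<odot> edge c z = 0"
      using that assms by (auto intro!: edge_disjoint)
    show ?thesis
      unfolding tri[OF t(1,2)] tri[OF t(3,4)] tri[OF t(5,6)] tri[OF t(7,8)] q mprod_linear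
      by (simp add: fun_eq_iff fun_ops algebra_simps)
  qed
  have zw: "?P z w" if "{z, w} \<subseteq> {1..n}" "{z, w} \<inter> {a, b, c} = {}" "z \<noteq> w" for z w
  proof -
    have "edge a b \<odot> edge z w = 0" "edge a c \<odot> edge z w = 0" "edge b c \<odot> edge z w = 0"
      using that assms by (auto intro!: edge_disjoint)
    then show ?thesis by (simp only: mprod_linear add_0_left)
  qed
  have sym: "?P u v \<Longrightarrow> ?P v u" for u v by (simp only: edge_commute[of u v])
  \<comment> \<open>The sum \<open>edge a c + edge b c\<close> is symmetric in \<open>a\<close> and
    \<open>b\<close>, so the cases at \<open>b\<close> are those at \<open>a\<close> with the two
    points exchanged.\<close>
  note swap = edge_commute[of b a] add.commute[of "edge b c"]
  have ac': "?P a c" and bc: "?P b c"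
    using ac[of a b c] ac[of b a c, unfolded swap] assms by auto
  have az': "?P a z" and bz: "?P b z" if "z \<in> {1..n}" "z \<notin> {a, b, c}" for z
    using az[of a b c z] az[of b a c z, unfolded swap] that assms by auto
  have all: "?P u v" if "u \<in> {a, b, c}" "v \<in> {1..n}" "u \<noteq> v" for u v
  proof (cases "v \<in> {a, b, c}")
    case True
    with that(1,3) show ?thesis using ab ac' bc sym by blast
  next
    case False
    with that(1,2) show ?thesis using az' bz cz by blast
  qed
  have xy: "x \<in> {1..n}" "y \<in> {1..n}" using assms(1) by auto
  show ?thesis
  proof (cases "{x, y} \<inter> {a, b, c} = {}")
    case True
    then show ?thesis using zw[of x y] assms(3) xy by blast
  next
    case False
    then have "x \<in> {a, b, c} \<or> y \<in> {a, b, c}" by blast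
    then show ?thesis using all[of x y] sym[OF all[of y x]] assms(3) xy by blast
  qed
qed

section \<open>Vectors annihilated by a transposition\<close>

definition mult_commute :: "(perm \<Rightarrow> 'f) \<Rightarrow> (perm \<Rightarrow> 'f) \<Rightarrow> bool" where
  "mult_commute a b \<longleftrightarrow> (\<forall>y\<in>alg (transps n). a \<odot> (b \<odot> y) = b \<odot> (a \<odot> y))"

lemma mult_commute_closed:
  "mult_commute a 0"
  "mult_commute a b \<Longrightarrow> mult_commute a c \<Longrightarrow> mult_commute a (b + c)"
  "mult_commute a b \<Longrightarrow> mult_commute a c \<Longrightarrow> mult_commute a (b - c)"
  "mult_commute a b \<Longrightarrow> mult_commute a (scl r b)"
  "mult_commute a a"
  by (auto simp: mult_commute_def mprod_linear)

lemma mult_commute_scl_iff: "r \<noteq> 0 \<Longrightarrow> mult_commute a (scl r b) \<longleftrightarrow> mult_commute a b"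
  using mult_commute_closed(4)[of a "scl r b" "1 / r"] mult_commute_closed(4)[of a b r]
  by (auto simp: scl_def)

lemma mult_commute_edges:
  assumes "\<And>x y. {x, y} \<subseteq> {1..n} \<Longrightarrow> x \<noteq> y \<Longrightarrow> a \<odot> (b \<odot> edge x y) = b \<odot> (a \<odot> edge x y)"
  shows "mult_commute a b"
  unfolding mult_commute_def
proof
  fix y :: "perm \<Rightarrow> 'f" assume "y \<in> alg (transps n)"
  with finite_transps show "a \<odot> (b \<odot> y) = b \<odot> (a \<odot> y)"
  proof (induction y rule: alg_induct)
    case (basis d)
    then show ?case using assms by (auto elim!: transps_cases simp: edge_def)
  qed (simp_all only: mprod_linear)
qed

text \<open>The polynomial \<open>(t - 1) * (t - \<alpha>)\<close>, evaluated at multiplication by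
  \<open>d\<close> and applied to \<open>g\<close>.\<close>

definition quad :: "(perm \<Rightarrow> 'f) \<Rightarrow> (perm \<Rightarrow> 'f) \<Rightarrow> perm \<Rightarrow> 'f" where
  "quad d g = d \<odot> (d \<odot> g) - scl (1 + \<alpha>) (d \<odot> g) + scl \<alpha> g"

text \<open>For disjoint edges \<open>quad\<close> scales by \<alpha>, for equal ones it gives zero,
  and for edges sharing a point it gives a combination of \<open>edge u w + edge v w\<close> and
  \<open>edge u v\<close>. The two commutation lemmas cover all of these.\<close>

lemma quad_edge_commute:
  assumes two: "(2::'f) \<noteq> 0"
    and "{a, b, x, y} \<subseteq> {1..n}" "a \<noteq> b" "x \<noteq> y"
  shows "mult_commute (edge a b) (quad (edge a b) (edge x y))"
proof -
  consider "{a, b} \<inter> {x, y} = {}" | u where "u \<in> {a, b}" "u \<in> {x, y}" by blast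
  then show ?thesis
  proof cases
    case 1
    have "edge a b \<odot> edge x y = 0" using assms 1 by (intro edge_disjoint) auto
    then have "quad (edge a b) (edge x y) = scl \<alpha> (edge x y)"
      by (simp add: quad_def mprod_linear) (simp add: fun_eq_iff fun_ops)
    moreover have "mult_commute (edge a b) (edge x y)"
      using assms 1 by (intro mult_commute_edges edges_commute_disjoint) auto
    ultimately show ?thesis by (simp add: mult_commute_closed)
  next
    case 2
    obtain v where v: "v \<in> {a, b}" "u \<noteq> v" "(edge u v :: perm \<Rightarrow> 'f) = edge a b"
      using edge_other[OF 2(1) assms(3)] .
    obtain w where w: "w \<in> {x, y}" "u \<noteq> w" "(edge u w :: perm \<Rightarrow> 'f) = edge x y"
      using edge_other[OF 2(2) assms(4)] .
    have uvw: "{u, v, w} \<subseteq> {1..n}" using 2 v(1) w(1) assms(2) by blast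
    show ?thesis
    proof (cases "v = w")
      case True
      then have e: "edge x y = (edge a b :: perm \<Rightarrow> 'f)" using v(3) w(3) by simp
      have aa: "edge a b \<odot> edge a b = edge a b" using assms by (intro edge_idem) auto
      have "quad (edge a b) (edge x y) = 0"
        unfolding quad_def e aa by (simp add: fun_eq_iff fun_ops algebra_simps)
      then show ?thesis by (simp add: mult_commute_closed)
    next
      case False
      define \<beta> where "\<beta> = \<alpha> / 2"
      have \<alpha>: "\<alpha> = 2 * \<beta>" using two by (simp add: \<beta>_def)
      have d: "distinct [u, v, w]" using False v(2) w(2) by simp
      have "edge u v \<odot> edge u v = edge u v" using uvw v(2) by (intro edge_idem) auto
      note t = this triangle[OF uvw d, folded \<beta>_def]
      have "quad (edge u v) (edge u w) = scl \<beta> (edge u w + edge v w) - scl (\<alpha> * \<beta>) (edge u v)"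
        unfolding quad_def t mprod_linear by (simp add: fun_eq_iff fun_ops algebra_simps \<alpha> two)
      moreover have "mult_commute (edge u v) (edge u w + edge v w)"
        by (intro mult_commute_edges edges_commute_adjacent) (use uvw d in auto)
      ultimately have "mult_commute (edge u v) (quad (edge u v) (edge u w))"
        by (simp add: mult_commute_closed)
      then show ?thesis unfolding v(3) w(3) .
    qed
  qed
qed

text \<open>
  For a transposition \<open>d\<close>, multiplication by \<open>d\<close> is annihilated by \<open>(t - 1) t (t - \<alpha>)\<close>, so
  \<open>quad d\<close> is, up to the factor \<open>\<alpha>\<close>, the projection to the 0-eigenspace of \<open>d\<close>.
\<close>

lemma mult_commute_zero_eigenvector:
  assumes "(2::'f) \<noteq> 0" "\<alpha> \<noteq> 0" and d: "d \<in> transps n"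
    and b: "b \<in> alg (transps n)" and "rho d \<odot> b = 0"
  shows "mult_commute (rho d) b"
proof -
  obtain i j where ij: "d = transpose i j" "i \<in> {1..n}" "j \<in> {1..n}" "i \<noteq> j"
    using d by (rule transps_cases)
  \<comment> \<open>This holds for every \<open>b\<close> and is linear in \<open>b\<close>, so
    basis vectors suffice; \<open>rho d \<odot> b = 0\<close> enters afterwards, turning
    \<open>quad (rho d) b\<close> into \<open>scl \<alpha> b\<close>.\<close>
  have "mult_commute (rho d) (quad (rho d) b)"
    using finite_transps b
  proof (induction b rule: alg_induct)
    case zero
    have "quad (rho d) 0 = 0"
      unfolding quad_def mprod_linear by (simp add: fun_eq_iff fun_ops)
    then show ?case by (simp add: mult_commute_closed)
  next
    case (add a b)
    have "quad (rho d) (a + b) = quad (rho d) a + quad (rho d) b"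
      unfolding quad_def mprod_linear by (simp add: fun_eq_iff fun_ops algebra_simps)
    with add show ?case by (simp add: mult_commute_closed)
  next
    case (scale r a)
    have "quad (rho d) (scl r a) = scl r (quad (rho d) a)"
      unfolding quad_def mprod_linear by (simp add: fun_eq_iff fun_ops algebra_simps)
    with scale show ?case by (simp add: mult_commute_closed)
  next
    case (basis g)
    then obtain x y where "g = transpose x y" "x \<in> {1..n}" "y \<in> {1..n}" "x \<noteq> y"
      by (rule transps_cases)
    then show ?case
      using quad_edge_commute[of i j x y] assms(1) ij by (simp add: edge_def)
  qed
  moreover have "quad (rho d) b = scl \<alpha> b"
    unfolding quad_def assms(5) mprod_linear by (simp add: fun_eq_iff fun_ops)
  ultimately show ?thesis using assms(2) by (simp add: mult_commute_scl_iff)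
qed

section \<open>The identity of a symmetric subgroup as an axis\<close>

context
  fixes m :: nat
  assumes two: "(2::'f) \<noteq> 0" and alpha: "\<alpha> \<noteq> 0" and m: "m \<le> n"
    and N: "1 + \<alpha> * (of_nat m - 2) \<noteq> 0"
begin

abbreviation idm :: "perm \<Rightarrow> 'f" where
  "idm \<equiv> sym_id \<alpha> m"

lemma sym_id_in_alg: "idm \<in> alg (transps m)"
  unfolding sym_id_def by (rule sum_rho_in_alg)

lemma sym_id_mult: "b \<in> alg (transps m) \<Longrightarrow> idm \<odot> b = b"
  using mprod_sum_rho[OF two m, of b \<alpha> "1 / (1 + \<alpha> * (of_nat m - 2))"] N
  by (simp add: sym_id_def) (simp add: fun_eq_iff fun_ops)

lemma sym_id_mult_sum:
  "idm \<odot> y = scl (1 / (1 + \<alpha> * (of_nat m - 2))) (\<Sum>d\<in>transps m. rho d \<odot> y)"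
  unfolding sym_id_def mprod_linear mprod_sum_left ..

lemma alg_sub: "alg (transps m) \<subseteq> (alg (transps n) :: (perm \<Rightarrow> 'f) set)"
  by (intro alg_mono transps_mono m)

lemma eta_eq: "eta \<alpha> m = \<alpha> / 2 * of_nat m / (1 + \<alpha> * (of_nat m - 2))"
proof -
  have "2 + 2 * \<alpha> * (of_nat m - 2) = 2 * (1 + \<alpha> * (of_nat m - 2))" by (simp add: algebra_simps)
  then show ?thesis using two N by (simp add: eta_def)
qed

text \<open>Among the transpositions of \<open>Sym m\<close>, only the edges \<open>a b\<close> have
  a nonzero product with \<open>edge a k\<close>. The full star sum \<open>U\<close> does not depend
  on \<open>a\<close>, so it disappears when two such edges are subtracted.\<close>

lemma sum_rho_mult_edge:
  assumes a: "a \<in> {1..m}" and k: "k \<in> {1..n}" "k \<notin> {1..m}"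
  defines "U \<equiv> \<Sum>b\<in>{1..m}. edge b k :: perm \<Rightarrow> 'f"
  shows "(\<Sum>d\<in>transps m. rho d) \<odot> edge a k - scl (\<alpha> / 2) (scl (of_nat m) (edge a k) - U)
    \<in> alg (transps m)"
proof -
  define \<beta> where "\<beta> = \<alpha> / 2"
  define K where "K = {1..m} - {a}"
  have K: "finite K" "card K = m - 1" "m \<ge> 1" using a by (auto simp: K_def)
  have sub: "transpose a ` K \<subseteq> transps m"
    using a by (auto simp: K_def intro!: transpose_in_transps)
  have rest: "rho d \<odot> edge a k = 0" if d: "d \<in> transps m - transpose a ` K" for d
  proof -
    obtain x y where xy: "d = transpose x y" "x \<in> {1..m}" "y \<in> {1..m}" "x \<noteq> y"
      using d by (auto elim: transps_cases)
    have "x \<noteq> a" "y \<noteq> a" using d xy by (auto simp: K_def transpose_commute)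
    then have "edge x y \<odot> edge a k = 0"
      using xy a k m by (intro edge_disjoint) auto
    then show ?thesis by (simp add: edge_def xy(1))
  qed
  have inj: "inj_on (transpose a) K"
    by (auto intro!: inj_onI simp: K_def) (metis transpose_apply_first)+
  have "(\<Sum>d\<in>transps m. rho d) \<odot> edge a k = (\<Sum>d\<in>transps m. rho d \<odot> edge a k)"
    by (rule mprod_sum_left)
  also have "\<dots> = (\<Sum>d\<in>transpose a ` K. rho d \<odot> edge a k)"
    using sub rest by (intro sum.mono_neutral_right) auto
  also have "\<dots> = (\<Sum>b\<in>K. edge a b \<odot> edge a k)"
    unfolding edge_def by (rule sum.reindex_cong[OF inj]) auto
  also have "\<dots> = (\<Sum>b\<in>K. scl \<beta> (edge a b + edge a k - edge b k))"
    unfolding \<beta>_def using a k m by (intro sum.cong refl edge_adjacent) (auto simp: K_def)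
  \<comment> \<open>There are \<open>m - 1\<close> copies of \<open>edge a k\<close>; completing the
    sum over \<open>K\<close> to \<open>U\<close> adds the term \<open>b = a\<close>, which accounts
    for the \<open>m\<close>-th copy.\<close>
  also have "\<dots> = scl \<beta> (\<Sum>b\<in>K. edge a b) + scl \<beta> (scl (of_nat m) (edge a k) - U)"
  proof
    fix x
    have "U x = edge a k x + (\<Sum>b\<in>K. edge b k x)"
      unfolding U_def K_def fun_ops using a by (intro sum.remove) auto
    moreover have "(of_nat m :: 'f) = 1 + of_nat (card K)" using K by (simp add: of_nat_diff)
    ultimately show "(\<Sum>b\<in>K. scl \<beta> (edge a b + edge a k - edge b k)) x
      = (scl \<beta> (\<Sum>b\<in>K. edge a b) + scl \<beta> (scl (of_nat m) (edge a k) - U)) x"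
      by (simp add: fun_ops sum.distrib sum_subtractf algebra_simps flip: sum_distrib_left)
  qed
  finally have "(\<Sum>d\<in>transps m. rho d) \<odot> edge a k - scl \<beta> (scl (of_nat m) (edge a k) - U)
      = scl \<beta> (\<Sum>b\<in>K. edge a b)"
    by simp
  moreover have "scl \<beta> (\<Sum>b\<in>K. edge a b) \<in> alg (transps m)"
    by (intro alg_closed alg_sum edge_in_alg) (use a in \<open>auto simp: K_def\<close>)
  ultimately show ?thesis unfolding \<beta>_def by simp
qed

text \<open>Modulo the subalgebra of \<open>Sym m\<close>, a product \<open>rho d \<odot> y\<close>
  is a combination of differences \<open>edge u w - edge v w\<close> with \<open>u\<close>,
  \<open>v\<close> inside and \<open>w\<close> outside \<open>{1..m}\<close>. On such differences
  \<open>idm\<close> acts as \<open>eta \<alpha> m\<close>.\<close>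

lemma sym_id_mult_mod:
  assumes d: "d \<in> transps m" and y: "y \<in> alg (transps n)"
  shows "idm \<odot> (rho d \<odot> y) - scl (eta \<alpha> m) (rho d \<odot> y) \<in> alg (transps m)"
  using finite_transps y
proof (induction y rule: alg_induct)
  case zero
  show ?case unfolding mprod_linear by (simp add: alg_def fun_ops)
next
  case (add a b)
  have "idm \<odot> (rho d \<odot> (a + b)) - scl (eta \<alpha> m) (rho d \<odot> (a + b))
    = (idm \<odot> (rho d \<odot> a) - scl (eta \<alpha> m) (rho d \<odot> a))
      + (idm \<odot> (rho d \<odot> b) - scl (eta \<alpha> m) (rho d \<odot> b))"
    unfolding mprod_linear by (simp add: fun_eq_iff fun_ops algebra_simps)
  then show ?case using add(3,4) by (simp only: alg_closed)
next
  case (scale r a)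
  have "idm \<odot> (rho d \<odot> scl r a) - scl (eta \<alpha> m) (rho d \<odot> scl r a)
    = scl r (idm \<odot> (rho d \<odot> a) - scl (eta \<alpha> m) (rho d \<odot> a))"
    unfolding mprod_linear by (simp add: fun_eq_iff fun_ops algebra_simps)
  then show ?case using scale(2) by (simp only: alg_closed)
next
  case (basis g)
  have in_m: ?case if "rho d \<odot> rho g \<in> alg (transps m)"
    using that by (simp add: sym_id_mult alg_closed)
  obtain a b where ab: "d = transpose a b" "a \<in> {1..m}" "b \<in> {1..m}" "a \<noteq> b"
    using d by (rule transps_cases)
  obtain x y where xy: "g = transpose x y" "x \<in> {1..n}" "y \<in> {1..n}" "x \<noteq> y"
    using basis by (rule transps_cases)
  consider "{a, b} \<inter> {x, y} = {}" | "{x, y} \<subseteq> {1..m}"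
    | u where "u \<in> {a, b}" "u \<in> {x, y}" "\<not> {x, y} \<subseteq> {1..m}" by blast
  then show ?case
  proof cases
    case 1
    have "edge a b \<odot> edge x y = 0" using 1 ab xy m by (intro edge_disjoint) auto
    then show ?thesis using in_m by (simp add: edge_def ab xy alg_closed)
  next
    case 2
    have "rho d \<odot> rho g \<in> alg (transps m)"
      using 2 d xy by (intro mprod_in_alg m rho_in_alg) (auto intro: transpose_in_transps)
    then show ?thesis by (rule in_m)
  next
    case 3
    obtain v where v: "v \<in> {a, b}" "u \<noteq> v" "(edge u v :: perm \<Rightarrow> 'f) = edge a b"
      using edge_other[OF 3(1) ab(4)] .
    obtain w where w: "w \<in> {x, y}" "u \<noteq> w" "(edge u w :: perm \<Rightarrow> 'f) = edge x y"
      using edge_other[OF 3(2) xy(4)] .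
    have uv: "u \<in> {1..m}" "v \<in> {1..m}" using 3(1) v(1) ab(2,3) by blast+
    have wn: "w \<in> {1..n}" using w(1) xy(2,3) by blast
    have wm: "w \<notin> {1..m}" using 3(2,3) w(1,2) uv(1) by blast
    define N' where "N' = 1 + \<alpha> * (of_nat m - 2)"
    define \<beta> where "\<beta> = \<alpha> / 2"
    define S where "S = (\<Sum>d\<in>transps m. rho d :: perm \<Rightarrow> 'f)"
    define U where "U = (\<Sum>b\<in>{1..m}. edge b w :: perm \<Rightarrow> 'f)"
    define z where "z i = S \<odot> edge i w - scl \<beta> (scl (of_nat m) (edge i w) - U)" for i
    have z: "z u \<in> alg (transps m)" "z v \<in> alg (transps m)"
      unfolding z_def S_def U_def \<beta>_def using uv wn wm by (intro sum_rho_mult_edge; simp)+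
    have S: "S \<odot> edge i w = z i + scl \<beta> (scl (of_nat m) (edge i w) - U)" for i
      by (simp add: z_def)
    have N': "N' \<noteq> 0" using N by (simp add: N'_def)
    have id: "idm = scl (1 / N') S" by (simp add: sym_id_def N'_def S_def)
    have eta: "eta \<alpha> m = \<beta> * of_nat m / N'" by (simp add: eta_eq \<beta>_def N'_def)
    have uvm: "edge u v \<in> alg (transps m)" using uv v(2) by (intro edge_in_alg)
    have S_uv: "scl (1 / N') S \<odot> edge u v = edge u v"
      using sym_id_mult[OF uvm] unfolding id .
    have t: "edge u v \<odot> edge u w = scl \<beta> (edge u v + edge u w - edge v w)"
      unfolding \<beta>_def using uv wn wm v(2) m by (intro triangle) auto
    have p: "rho d \<odot> rho g = scl \<beta> (edge u v + edge u w - edge v w)"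
      using t unfolding v(3) w(3) by (simp add: edge_def ab xy)
    \<comment> \<open>The two copies of \<open>U\<close> cancel, and
      \<open>\<beta> * of_nat m / N'\<close> is exactly \<open>eta \<alpha> m\<close>; what remains
      lies in the subalgebra.\<close>
    have "idm \<odot> (rho d \<odot> rho g) - scl (eta \<alpha> m) (rho d \<odot> rho g)
      = scl \<beta> (scl (1 - eta \<alpha> m) (edge u v) + scl (1 / N') (z u - z v))"
      unfolding p id mprod_diff_right mprod_scl_right mprod_add_right S_uv
      unfolding mprod_linear S
      by (simp add: fun_eq_iff fun_ops eta diff_divide_distrib add_divide_distrib algebra_simps)
    moreover have "\<dots> \<in> alg (transps m)" using z uvm by (intro alg_closed)
    ultimately show ?thesis by simp
  qed
qed

text \<open>The vector \<open>idm \<odot> y\<close> is a combination of products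
  \<open>rho d \<odot> y\<close>. Since \<open>idm\<close> fixes \<open>alg (transps m)\<close>,
  multiplication by \<open>idm\<close> is therefore annihilated by
  \<open>(t - 1) * t * (t - eta \<alpha> m)\<close>.\<close>

lemma sym_id_square_mod:
  assumes y: "y \<in> alg (transps n)"
  shows "idm \<odot> (idm \<odot> y) - scl (eta \<alpha> m) (idm \<odot> y) \<in> alg (transps m)"
proof -
  define r where "r = 1 / (1 + \<alpha> * (of_nat m - 2))"
  have "idm \<odot> y = scl r (\<Sum>d\<in>transps m. rho d \<odot> y)"
    by (simp add: sym_id_mult_sum r_def)
  then have "idm \<odot> (idm \<odot> y) - scl (eta \<alpha> m) (idm \<odot> y)
      = scl r (\<Sum>d\<in>transps m. idm \<odot> (rho d \<odot> y) - scl (eta \<alpha> m) (rho d \<odot> y))"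
    by (simp only: mprod_scl_right mprod_sum_right)
      (simp add: fun_eq_iff fun_ops sum_subtractf algebra_simps sum_distrib_left)
  moreover have "\<dots> \<in> alg (transps m)"
    by (intro alg_closed alg_sum sym_id_mult_mod y)
  ultimately show ?thesis by simp
qed

lemma mult_commute_transp_sym_id:
  assumes d: "d \<in> transps m"
  shows "mult_commute (rho d) idm"
proof -
  define b where "b = idm - rho d"
  have dm: "rho d \<in> (alg (transps m) :: (perm \<Rightarrow> 'f) set)" using d by (rule rho_in_alg)
  have dn: "d \<in> transps n" using d transps_mono[OF m] by blast
  have dd: "rho d \<odot> rho d = rho d" using dn by (simp add: mprod_rho basis_prod_def)
  have "rho d \<odot> b = 0"
    unfolding b_def mprod_diff_right dd using sym_id_mult[OF dm] mprod_commute[of \<alpha> n] by simp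
  moreover have "b \<in> alg (transps n)"
    unfolding b_def using sym_id_in_alg dm alg_sub by (intro alg_closed) auto
  ultimately have "mult_commute (rho d) b"
    using two alpha dn by (intro mult_commute_zero_eigenvector)
  then have "mult_commute (rho d) (b + rho d)"
    by (intro mult_commute_closed)
  then show ?thesis by (simp add: b_def)
qed


text \<open>Multiplication by \<open>idm\<close> is a linear combination of the multiplications by
  the \<open>rho d\<close>. The case of interest is a 0-eigenvector \<open>b\<close> of
  \<open>idm\<close>.\<close>

lemma mult_commute_sym_id_zero:
  assumes "\<And>d. d \<in> transps m \<Longrightarrow> mult_commute (rho d) b"
  shows "mult_commute idm b"
  using assms unfolding mult_commute_def sym_id_mult_sum mprod_linear mprod_sum_right by simp

lemma mult_commute_alg_sym_id:
  assumes "a \<in> alg (transps m)" "y \<in> alg (transps n)"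
  shows "a \<odot> (idm \<odot> y) = idm \<odot> (a \<odot> y)"
  using finite_transps assms(1)
proof (induction a rule: alg_induct)
  case (basis d)
  then show ?case using mult_commute_transp_sym_id assms(2) by (simp add: mult_commute_def)
qed (simp_all only: mprod_linear)

section \<open>Eigenspaces of the identity element\<close>

context
  assumes eta: "eta \<alpha> m \<noteq> 0" "eta \<alpha> m \<noteq> 1"
begin

text \<open>If \<open>idm\<close> fixes \<open>b\<close>, then \<open>sym_id_square_mod\<close>
  places \<open>(1 - eta \<alpha> m)\<close> times \<open>b\<close> in the subalgebra, and this
  factor is invertible.\<close>

lemma eigenspace_sym_id_1: "eigenspace \<alpha> (transps n) idm 1 = alg (transps m)"
proof (intro equalityI subsetI)
  fix b assume "b \<in> eigenspace \<alpha> (transps n) idm 1"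
  then have b: "b \<in> alg (transps n)" "idm \<odot> b = b"
    by (simp_all add: eigenspace_def scl_def)
  have "b - scl (eta \<alpha> m) b \<in> alg (transps m)"
    using sym_id_square_mod[OF b(1)] unfolding b(2) .
  moreover have "b = scl (1 / (1 - eta \<alpha> m)) (b - scl (eta \<alpha> m) b)"
    using eta(2) by (simp add: fun_eq_iff fun_ops field_simps)
  ultimately show "b \<in> alg (transps m)" by (metis alg_closed(4))
next
  fix b :: "perm \<Rightarrow> 'f" assume b: "b \<in> alg (transps m)"
  then show "b \<in> eigenspace \<alpha> (transps n) idm 1"
    using alg_sub sym_id_mult[OF b] by (auto simp: eigenspace_def scl_def)
qed

text \<open>Put \<open>w = rho d \<odot> b\<close>. Commutation gives
  \<open>idm \<odot> w = 0\<close>, so the congruence for \<open>idm \<odot> w\<close> puts a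
  nonzero multiple of \<open>w\<close> in the subalgebra; there \<open>idm\<close> is the identity,
  whence \<open>w = 0\<close>.\<close>

lemma eigenspace_sym_id_0:
  assumes b: "b \<in> eigenspace \<alpha> (transps n) idm 0" and d: "d \<in> transps m"
  shows "rho d \<odot> b = 0"
proof -
  define w where "w = rho d \<odot> b"
  have bn: "b \<in> alg (transps n)" and eb: "idm \<odot> b = 0"
    using b by (simp_all add: eigenspace_def) (simp add: fun_eq_iff fun_ops)
  have "idm \<odot> w = 0"
    using mult_commute_alg_sym_id[OF rho_in_alg[OF d] bn]
    unfolding w_def eb mprod_linear by simp
  moreover have "w = scl (- 1 / eta \<alpha> m) (0 - scl (eta \<alpha> m) w)"
    using eta(1) by (simp add: fun_eq_iff fun_ops)
  moreover have "idm \<odot> w - scl (eta \<alpha> m) w \<in> alg (transps m)"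
    unfolding w_def using sym_id_mult_mod[OF d bn] .
  ultimately have "w \<in> alg (transps m)" by (metis alg_closed(4))
  then have "w = 0" using sym_id_mult \<open>idm \<odot> w = 0\<close> by simp
  then show ?thesis by (simp add: w_def)
qed

lemma peirce_axis_sym_id: "peirce_axis \<alpha> n idm (eta \<alpha> m)"
proof
  let ?V = "eigenspace \<alpha> (transps n) idm"
  show en: "idm \<in> alg (transps n)" using sym_id_in_alg alg_sub by blast
  show "idm \<odot> idm = idm" by (rule sym_id_mult[OF sym_id_in_alg])
  show "eta \<alpha> m \<noteq> 0" "eta \<alpha> m \<noteq> 1" by (fact eta)+
  show "\<exists>b1\<in>?V 1. \<exists>b0\<in>?V 0. \<exists>b2\<in>?V (eta \<alpha> m). b = b1 + b0 + b2"
    if b: "b \<in> alg (transps n)" for b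
  proof -
    define h where "h = eta \<alpha> m"
    define u where "u = idm \<odot> b"
    define v where "v = idm \<odot> u"
    have h: "h \<noteq> 0" "h \<noteq> 1" "h - 1 \<noteq> 0" "1 - h \<noteq> 0" using eta by (simp_all add: h_def)
    have un: "u \<in> alg (transps n)" and vn: "v \<in> alg (transps n)"
      unfolding u_def v_def by (rule mprod_range)+
    have "idm \<odot> (v - scl h u) = v - scl h u"
      unfolding v_def u_def h_def by (intro sym_id_mult sym_id_square_mod b)
    then have "idm \<odot> v = (v - scl h u) + scl h v"
      unfolding mprod_linear v_def[symmetric] by (simp add: algebra_simps)
    note e = this u_def[symmetric] v_def[symmetric]
    \<comment> \<open>Lagrange interpolation: the three vectors arise from the quadratic polynomials
      that are 1 at one of the roots 1, 0, \<open>h\<close> and 0 at the other two, evaluated at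
      multiplication by \<open>idm\<close>.\<close>
    define b1 where "b1 = scl (1 / (1 - h)) (v - scl h u)"
    define b0 where "b0 = scl (1 / h) (v - scl (1 + h) u + scl h b)"
    define b2 where "b2 = scl (1 / (h * (h - 1))) (v - u)"
    have "b1 \<in> ?V 1"
      unfolding eigenspace_def b1_def mem_Collect_eq mprod_linear e
      by (intro conjI alg_closed un vn) (simp add: fun_eq_iff fun_ops)
    moreover have "b0 \<in> ?V 0"
      unfolding eigenspace_def b0_def mem_Collect_eq mprod_linear e
      by (intro conjI alg_closed un vn b) (simp add: fun_eq_iff fun_ops algebra_simps diff_divide_distrib)
    moreover have "b2 \<in> ?V h"
      unfolding eigenspace_def b2_def mem_Collect_eq mprod_linear e
      by (intro conjI alg_closed un vn b) (simp add: fun_eq_iff fun_ops algebra_simps diff_divide_distrib)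
    moreover have "b = b1 + b0 + b2"
    proof -
      have "y = 1 / (1 - h) * (v' - h * u') + 1 / h * (v' - (1 + h) * u' + h * y)
        + 1 / (h * (h - 1)) * (v' - u')" for y u' v'
      proof -
        have "1 / (1 - h) = - 1 / (h - 1)"
          using h by (simp add: divide_simps)
        then show ?thesis using h by (simp add: divide_simps) (simp add: algebra_simps)
      qed
      then show ?thesis by (simp add: fun_eq_iff fun_ops b1_def b0_def b2_def)
    qed
    ultimately show ?thesis unfolding h_def by blast
  qed
  show "a \<odot> b \<in> ?V \<kappa>" if a: "a \<in> ?V 1" and b: "b \<in> ?V \<kappa>" for a b \<kappa>
  proof -
    have am: "a \<in> alg (transps m)" using a by (simp add: eigenspace_sym_id_1)
    have bn: "b \<in> alg (transps n)" and eb: "idm \<odot> b = scl \<kappa> b"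
      using b by (simp_all add: eigenspace_def)
    have "idm \<odot> (a \<odot> b) = scl \<kappa> (a \<odot> b)"
      using mult_commute_alg_sym_id[OF am bn] unfolding eb mprod_linear by simp
    then show ?thesis by (simp add: eigenspace_def mprod_range)
  qed
  show "a \<odot> b \<in> ?V \<kappa>" if a: "a \<in> ?V 0" and b: "b \<in> ?V \<kappa>" for a b \<kappa>
  proof -
    have an: "a \<in> alg (transps n)" using a by (simp add: eigenspace_def)
    have bn: "b \<in> alg (transps n)" and eb: "idm \<odot> b = scl \<kappa> b"
      using b by (simp_all add: eigenspace_def)
    \<comment> \<open>Each \<open>rho d\<close> with \<open>d\<close> in \<open>transps m\<close>
      annihilates \<open>a\<close>, so its multiplication commutes with that of \<open>a\<close>;
      summing over \<open>d\<close> gives \<open>idm\<close>.\<close>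
    have "mult_commute idm a"
      using transps_mono[OF m] a two alpha an
      by (intro mult_commute_sym_id_zero mult_commute_zero_eigenvector eigenspace_sym_id_0) auto
    then have "idm \<odot> (a \<odot> b) = scl \<kappa> (a \<odot> b)"
      using bn unfolding mult_commute_def by (metis eb mprod_scl_right)
    then show ?thesis by (simp add: eigenspace_def mprod_range)
  qed
qed

end
end

end

section \<open>Joint eigenspaces of two nested axes\<close>

lemma eigenspace_closed:
  "0 \<in> eigenspace \<alpha> D x \<kappa>"
  "a \<in> eigenspace \<alpha> D x \<kappa> \<Longrightarrow> b \<in> eigenspace \<alpha> D x \<kappa> \<Longrightarrow> a + b \<in> eigenspace \<alpha> D x \<kappa>"
  "a \<in> eigenspace \<alpha> D x \<kappa> \<Longrightarrow> b \<in> eigenspace \<alpha> D x \<kappa> \<Longrightarrow> a - b \<in> eigenspace \<alpha> D x \<kappa>"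
  "a \<in> eigenspace \<alpha> D x \<kappa> \<Longrightarrow> scl r a \<in> eigenspace \<alpha> D x \<kappa>"
  by (auto simp: eigenspace_def alg_closed mprod_linear)
    (auto simp: fun_eq_iff fun_ops algebra_simps)

text \<open>Multiplying the relation by \<open>x\<close> and subtracting \<nu> times it removes the
  \<nu>-term and scales every other term by a nonzero \<open>\<kappa> - \<nu>\<close>.\<close>

lemma eigenspace_independent:
  assumes "finite T" "\<And>\<kappa>. \<kappa> \<in> T \<Longrightarrow> f \<kappa> \<in> eigenspace \<alpha> D x \<kappa>" "(\<Sum>\<kappa>\<in>T. f \<kappa>) = 0" "\<kappa> \<in> T"
  shows "f \<kappa> = 0"
  using assms
proof (induction T arbitrary: f \<kappa> rule: finite_induct)
  case (insert \<nu> T)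
  have x: "mprod \<alpha> D x (f \<kappa>) = scl \<kappa> (f \<kappa>)" if "\<kappa> \<in> insert \<nu> T" for \<kappa>
    using insert.prems(1)[OF that] by (simp add: eigenspace_def)
  have "mprod \<alpha> D x (\<Sum>\<kappa>\<in>insert \<nu> T. f \<kappa>) = (\<Sum>\<kappa>\<in>insert \<nu> T. scl \<kappa> (f \<kappa>))"
    unfolding mprod_sum_right by (intro sum.cong refl x)
  then have 1: "(\<Sum>\<kappa>\<in>insert \<nu> T. scl \<kappa> (f \<kappa>)) = 0"
    unfolding insert.prems(2) mprod_linear by simp
  have "(\<Sum>\<kappa>\<in>T. scl (\<kappa> - \<nu>) (f \<kappa>))
      = (\<Sum>\<kappa>\<in>insert \<nu> T. scl \<kappa> (f \<kappa>)) - scl \<nu> (\<Sum>\<kappa>\<in>insert \<nu> T. f \<kappa>)"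
    using insert.hyps
    by (simp add: fun_eq_iff fun_ops sum_subtractf sum_distrib_left algebra_simps)
  also have "\<dots> = 0" unfolding 1 insert.prems(2) by (simp add: fun_eq_iff fun_ops)
  finally have 2: "(\<Sum>\<kappa>\<in>T. scl (\<kappa> - \<nu>) (f \<kappa>)) = 0" .
  have 3: "f \<mu> = 0" if "\<mu> \<in> T" for \<mu>
  proof -
    have "scl (\<mu> - \<nu>) (f \<mu>) = 0"
      by (rule insert.IH[OF _ 2 that]) (simp add: insert.prems(1) eigenspace_closed(4))
    moreover have "\<mu> \<noteq> \<nu>" using that insert.hyps by blast
    ultimately show ?thesis by (simp add: fun_eq_iff fun_ops)
  qed
  then have "f \<nu> = 0" using insert.prems(2) insert.hyps by simp
  then show ?case using 3 insert.prems(3) by blast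
qed simp

lemma eigenspace_disjoint:
  assumes "a \<in> eigenspace \<alpha> D x \<kappa>" "a \<in> eigenspace \<alpha> D x \<mu>" "\<kappa> \<noteq> \<mu>"
  shows "a = 0"
proof -
  have "scl \<kappa> a = scl \<mu> a" using assms by (simp add: eigenspace_def)
  then show ?thesis using assms(3) by (simp add: fun_eq_iff fun_ops)
qed

text \<open>Turns a decomposition with known summands into an upper bound for each
  eigenspace.\<close>

lemma eigenspace_component:
  assumes T: "finite T" "\<And>\<kappa>. \<kappa> \<in> T \<Longrightarrow> f \<kappa> \<in> eigenspace \<alpha> D x \<kappa>"
    and a: "a = (\<Sum>\<kappa>\<in>T. f \<kappa>)" "\<mu> \<in> T" "a \<in> eigenspace \<alpha> D x \<mu>"
  shows "a = f \<mu>"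
proof -
  define g where "g \<kappa> = f \<kappa> - (if \<kappa> = \<mu> then a else 0)" for \<kappa>
  have "g \<kappa> \<in> eigenspace \<alpha> D x \<kappa>" if "\<kappa> \<in> T" for \<kappa>
    using T(2)[OF that] a(3) by (auto simp: g_def eigenspace_closed)
  moreover have "(\<Sum>\<kappa>\<in>T. g \<kappa>) = 0"
    using T(1) a(1,2) by (simp add: g_def sum_subtractf)
  ultimately have "g \<mu> = 0" using a(2) by (rule eigenspace_independent[OF T(1)])
  then show ?thesis by (simp add: g_def)
qed

lemma eigenspace_sumI:
  assumes "v \<in> eigenspace \<alpha> D x \<kappa>" "\<kappa> \<in> \<Lambda>"
  shows "v \<in> eigenspace_sum \<alpha> D x \<Lambda>"
  unfolding eigenspace_sum_def using assms
  by (intro CollectI exI[of _ "{\<kappa>}"] exI[of _ "\<lambda>_. v"]) auto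

lemma zero_in_eigenspace_sum: "0 \<in> eigenspace_sum \<alpha> D x \<Lambda>"
  unfolding eigenspace_sum_def by (intro CollectI exI[of _ "{}"]) auto

lemma eigenspace_sum_add:
  assumes "a \<in> eigenspace_sum \<alpha> D x \<Lambda>" "b \<in> eigenspace_sum \<alpha> D x \<Lambda>"
  shows "a + b \<in> eigenspace_sum \<alpha> D x \<Lambda>"
proof -
  obtain T f where T: "a = (\<Sum>\<kappa>\<in>T. f \<kappa>)" "finite T" "T \<subseteq> \<Lambda>" "\<forall>\<kappa>\<in>T. f \<kappa> \<in> eigenspace \<alpha> D x \<kappa>"
    using assms(1) by (auto simp: eigenspace_sum_def)
  obtain U g where U: "b = (\<Sum>\<kappa>\<in>U. g \<kappa>)" "finite U" "U \<subseteq> \<Lambda>" "\<forall>\<kappa>\<in>U. g \<kappa> \<in> eigenspace \<alpha> D x \<kappa>"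
    using assms(2) by (auto simp: eigenspace_sum_def)
  \<comment> \<open>Each family is extended by zero, which lies in every eigenspace, so that both
    can be summed over the union.\<close>
  define h where "h \<kappa> = (if \<kappa> \<in> T then f \<kappa> else 0) + (if \<kappa> \<in> U then g \<kappa> else 0)" for \<kappa>
  have "(\<Sum>\<kappa>\<in>T \<union> U. h \<kappa>) = (\<Sum>\<kappa>\<in>T \<union> U. if \<kappa> \<in> T then f \<kappa> else 0)
      + (\<Sum>\<kappa>\<in>T \<union> U. if \<kappa> \<in> U then g \<kappa> else 0)"
    unfolding h_def by (rule sum.distrib)
  also have "(\<Sum>\<kappa>\<in>T \<union> U. if \<kappa> \<in> T then f \<kappa> else 0) = a"
    unfolding T(1) by (rule sum.mono_neutral_cong_right) (use T U in auto)
  also have "(\<Sum>\<kappa>\<in>T \<union> U. if \<kappa> \<in> U then g \<kappa> else 0) = b"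
    unfolding U(1) by (rule sum.mono_neutral_cong_right) (use T U in auto)
  finally have "a + b = (\<Sum>\<kappa>\<in>T \<union> U. h \<kappa>)" ..
  moreover have "\<forall>\<kappa>\<in>T \<union> U. h \<kappa> \<in> eigenspace \<alpha> D x \<kappa>"
    using T(4) U(4) by (auto simp: h_def eigenspace_closed)
  ultimately show ?thesis unfolding eigenspace_sum_def using T(2,3) U(2,3)
    by (intro CollectI exI[of _ "T \<union> U"] exI[of _ h]) auto
qed

section \<open>Decompositions and multiplications relative to one axis\<close>

context peirce_axis
begin

text \<open>Since the multiplications commute, \<open>r\<close>, which measures the failure to be a
  \<mu>-eigenvector of \<open>x\<close>, preserves the eigenspaces of \<open>e\<close>. The images
  of the components of \<open>y\<close> under \<open>r\<close> sum to zero, hence each is zero by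
  independence.\<close>

lemma joint_decomp:
  assumes comm: "mult_commute \<alpha> n x e" and y: "y \<in> eigenspace \<alpha> (transps n) x \<mu>"
  obtains y1 y0 y2 where "y = y1 + y0 + y2"
    "y1 \<in> eigenspace \<alpha> (transps n) e 1 \<inter> eigenspace \<alpha> (transps n) x \<mu>"
    "y0 \<in> eigenspace \<alpha> (transps n) e 0 \<inter> eigenspace \<alpha> (transps n) x \<mu>"
    "y2 \<in> eigenspace \<alpha> (transps n) e \<eta> \<inter> eigenspace \<alpha> (transps n) x \<mu>"
proof -
  let ?V = "eigenspace \<alpha> (transps n)" and ?m = "mprod \<alpha> (transps n)"
  have yn: "y \<in> alg (transps n)" and xy: "?m x y = scl \<mu> y" using y by (simp_all add: eigenspace_def)
  obtain y1 y0 y2 where d: "y1 \<in> ?V e 1" "y0 \<in> ?V e 0" "y2 \<in> ?V e \<eta>" "y = y1 + y0 + y2"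
    using decomp[OF yn] by blast
  define r where "r z = ?m x z - scl \<mu> z" for z
  have r: "r z \<in> ?V e \<kappa>" if z: "z \<in> ?V e \<kappa>" for z \<kappa>
  proof -
    have "z \<in> alg (transps n)" "?m e z = scl \<kappa> z" using z by (simp_all add: eigenspace_def)
    then have "?m e (?m x z) = scl \<kappa> (?m x z)"
      using comm unfolding mult_commute_def by (metis mprod_scl_right)
    then have "?m x z \<in> ?V e \<kappa>" by (simp add: eigenspace_def mprod_range)
    then show ?thesis unfolding r_def using z by (intro eigenspace_closed)
  qed
  define f where "f \<kappa> = (if \<kappa> = 1 then r y1 else if \<kappa> = 0 then r y0 else r y2)" for \<kappa> :: 'f
  have "r y1 + r y0 + r y2 = r y"
    unfolding r_def d(4) mprod_linear by (simp add: fun_eq_iff fun_ops algebra_simps)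
  also have "\<dots> = 0" unfolding r_def xy by simp
  finally have "(\<Sum>\<kappa>\<in>{1, 0, \<eta>}. f \<kappa>) = 0"
    using non_degenerate by (simp add: f_def add.assoc)
  moreover have "f \<kappa> \<in> ?V e \<kappa>" if "\<kappa> \<in> {1, 0, \<eta>}" for \<kappa>
    using that non_degenerate r[OF d(1)] r[OF d(2)] r[OF d(3)] by (auto simp: f_def)
  ultimately have "f \<kappa> = 0" if "\<kappa> \<in> {1, 0, \<eta>}" for \<kappa>
    using that by (intro eigenspace_independent[of "{1, 0, \<eta>}" f]) auto
  from this[of 1] this[of 0] this[of \<eta>] have "r y1 = 0" "r y0 = 0" "r y2 = 0"
    using non_degenerate by (simp_all add: f_def)
  then have "y1 \<in> ?V x \<mu>" "y0 \<in> ?V x \<mu>" "y2 \<in> ?V x \<mu>"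
    using d by (simp_all add: r_def eigenspace_def)
  then show thesis using that d by blast
qed

text \<open>The product lies in the 0-eigenspace by \<open>mult_1\<close> and in the 1-eigenspace by
  \<open>mult_0\<close>.\<close>

lemma mult_1_0:
  assumes "a \<in> eigenspace \<alpha> (transps n) e 1" "b \<in> eigenspace \<alpha> (transps n) e 0"
  shows "mprod \<alpha> (transps n) a b = 0"
proof -
  have "mprod \<alpha> (transps n) a b \<in> eigenspace \<alpha> (transps n) e 1"
    using mult_0[OF assms(2,1)] mprod_commute[of \<alpha> n b a] by simp
  then show ?thesis using mult_1[OF assms] by (rule eigenspace_disjoint) simp
qed

text \<open>Multiplication by \<open>a\<close> preserves every eigenspace of \<open>e\<close>, and
  on each of them \<open>e\<close> acts as a scalar.\<close>

lemma mult_commute_axis: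
  assumes a: "a \<in> eigenspace \<alpha> (transps n) e 1"
  shows "mult_commute \<alpha> n a e"
  unfolding mult_commute_def
proof
  let ?m = "mprod \<alpha> (transps n)"
  fix y :: "perm \<Rightarrow> 'f" assume "y \<in> alg (transps n)"
  then obtain y1 y0 y2 where y: "y1 \<in> eigenspace \<alpha> (transps n) e 1"
    "y0 \<in> eigenspace \<alpha> (transps n) e 0" "y2 \<in> eigenspace \<alpha> (transps n) e \<eta>" "y = y1 + y0 + y2"
    using decomp by blast
  have "?m a (?m e z) = ?m e (?m a z)" if "z \<in> eigenspace \<alpha> (transps n) e \<kappa>" for z \<kappa>
    using that mult_1[OF a that] by (simp add: eigenspace_def mprod_scl_right)
  then show "?m a (?m e y) = ?m e (?m a y)"
    unfolding y(4) mprod_add_right using y(1-3) by metis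
qed

end

text \<open>The nesting of the two subgroups is expressed by \<open>f_below\<close> and
  \<open>below\<close>.\<close>

locale peirce_axis_pair =
  E: peirce_axis \<alpha> n e p + F: peirce_axis \<alpha> n f q
  for \<alpha> :: "'f::field" and n :: nat and e f :: "perm \<Rightarrow> 'f" and p q :: 'f +
  assumes f_below: "f \<in> eigenspace \<alpha> (transps n) e 1"
    and below: "eigenspace \<alpha> (transps n) f 1 \<subseteq> eigenspace \<alpha> (transps n) e 1"
    and distinct: "distinct (coset_eigenvalues p q)"
begin

abbreviation mul :: "(perm \<Rightarrow> 'f) \<Rightarrow> (perm \<Rightarrow> 'f) \<Rightarrow> perm \<Rightarrow> 'f" (infixl "\<odot>" 70) where
  "a \<odot> b \<equiv> mprod \<alpha> (transps n) a b"

definition joint :: "'f \<Rightarrow> 'f \<Rightarrow> (perm \<Rightarrow> 'f) set" where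
  "joint \<kappa> \<mu> = eigenspace \<alpha> (transps n) e \<kappa> \<inter> eigenspace \<alpha> (transps n) f \<mu>"

abbreviation X :: "'f \<Rightarrow> (perm \<Rightarrow> 'f) set" where
  "X \<equiv> eigenspace \<alpha> (transps n) (e - f)"

abbreviation XS :: "'f set \<Rightarrow> (perm \<Rightarrow> 'f) set" where
  "XS \<equiv> eigenspace_sum \<alpha> (transps n) (e - f)"

lemma commute_fe: "mult_commute \<alpha> n f e"
  by (rule E.mult_commute_axis[OF f_below])

lemma commute_ef: "mult_commute \<alpha> n e f"
  using commute_fe by (simp add: mult_commute_def)

lemma joint_X: "a \<in> joint \<kappa> \<mu> \<Longrightarrow> a \<in> X (\<kappa> - \<mu>)"
  by (simp add: joint_def eigenspace_def mprod_diff_left) (simp add: fun_eq_iff fun_ops algebra_simps)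

lemma joint_mult:
  assumes "a \<in> joint \<kappa> \<mu>" "b \<in> joint \<kappa>' \<mu>'" "\<kappa> \<in> {0, 1}" "\<mu> \<in> {0, 1}"
  shows "a \<odot> b \<in> joint \<kappa>' \<mu>'"
  using assms E.mult_1 E.mult_0 F.mult_1 F.mult_0 by (auto simp: joint_def)

text \<open>Excludes the pair \<open>(p, 1)\<close>: by \<open>below\<close>, such a vector is also
  a 1-eigenvector of \<open>e\<close>.\<close>

lemma joint_p1: "a \<in> joint p 1 \<Longrightarrow> a = 0"
  using below E.non_degenerate eigenspace_disjoint[of a \<alpha> "transps n" e p 1]
  by (auto simp: joint_def)

text \<open>As a 1-eigenvector of \<open>e\<close>, the axis \<open>f\<close> annihilates the
  0-eigenspace of \<open>e\<close>. This excludes the pairs \<open>(0, 1)\<close> and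
  \<open>(0, q)\<close>.\<close>

lemma eigenspace_e_0:
  assumes "a \<in> eigenspace \<alpha> (transps n) e 0"
  shows "a \<in> joint 0 0"
proof -
  have "f \<odot> a = 0" using E.mult_1_0[OF f_below assms] .
  moreover have "scl 0 a = 0" by (simp add: fun_eq_iff fun_ops)
  ultimately show ?thesis using assms by (simp add: joint_def eigenspace_def)
qed

lemma joint_0q:
  assumes "a \<in> joint 0 q"
  shows "a = 0"
  using eigenspace_e_0[of a] eigenspace_disjoint[of a \<alpha> "transps n" f 0 q] assms
    F.non_degenerate
  by (auto simp: joint_def)

lemma eigenspace_e_1:
  assumes "a \<in> eigenspace \<alpha> (transps n) e 1"
  obtains a1 a0 a2 where "a = a1 + a0 + a2" "a1 \<in> joint 1 1" "a0 \<in> joint 1 0" "a2 \<in> joint 1 q"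
  using F.joint_decomp[OF commute_ef assms] unfolding joint_def by (metis Int_commute)

lemma eigenspace_e_p:
  assumes "a \<in> eigenspace \<alpha> (transps n) e p"
  obtains a0 a2 where "a = a0 + a2" "a0 \<in> joint p 0" "a2 \<in> joint p q"
proof -
  obtain a1 a0 a2 where "a = a1 + a0 + a2" "a1 \<in> joint p 1" "a0 \<in> joint p 0" "a2 \<in> joint p q"
    using F.joint_decomp[OF commute_ef assms] unfolding joint_def by (metis Int_commute)
  then show thesis using that joint_p1[of a1] by simp
qed

lemma eigenspace_f_0:
  assumes "a \<in> eigenspace \<alpha> (transps n) f 0"
  obtains a1 a0 a2 where "a = a1 + a0 + a2" "a1 \<in> joint 1 0" "a0 \<in> joint 0 0" "a2 \<in> joint p 0"
  using E.joint_decomp[OF commute_fe assms] unfolding joint_def by metis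

lemma eigenspace_f_q:
  assumes "a \<in> eigenspace \<alpha> (transps n) f q"
  obtains a1 a2 where "a = a1 + a2" "a1 \<in> joint 1 q" "a2 \<in> joint p q"
proof -
  obtain a1 a0 a2 where "a = a1 + a0 + a2" "a1 \<in> joint 1 q" "a0 \<in> joint 0 q" "a2 \<in> joint p q"
    using E.joint_decomp[OF commute_fe assms] unfolding joint_def by metis
  then show thesis using that joint_0q[of a0] by simp
qed

section \<open>The eigenspaces of the difference \<open>e - f\<close>\<close>

abbreviation \<Phi> :: "'f set" where
  "\<Phi> \<equiv> {1, 0, p, 1 - q, p - q}"

lemma distinct_eigenvalues:
  "p \<noteq> 0" "p \<noteq> 1" "1 - q \<noteq> 0" "1 - q \<noteq> 1" "1 - q \<noteq> p" "p - q \<noteq> 0" "p - q \<noteq> 1" "p - q \<noteq> p"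
  "p - q \<noteq> 1 - q"
  using distinct by (auto simp: coset_eigenvalues_def)

text \<open>A pair of eigenvalues contributes to their difference. The difference 0 arises from both
  \<open>(1, 1)\<close> and \<open>(0, 0)\<close>, hence the sum in that branch; the last branch is
  meant for \<open>p - q\<close>.\<close>

definition X_joint :: "'f \<Rightarrow> (perm \<Rightarrow> 'f) set" where
  "X_joint \<kappa> =
    (if \<kappa> = 1 then joint 1 0
     else if \<kappa> = 0 then {a + b | a b. a \<in> joint 1 1 \<and> b \<in> joint 0 0}
     else if \<kappa> = p then joint p 0
     else if \<kappa> = 1 - q then joint 1 q
     else joint p q)"

lemma X_joint_simps:
  "X_joint 1 = joint 1 0"
  "X_joint 0 = {a + b | a b. a \<in> joint 1 1 \<and> b \<in> joint 0 0}"
  "X_joint p = joint p 0"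
  "X_joint (1 - q) = joint 1 q"
  "X_joint (p - q) = joint p q"
  unfolding X_joint_def using distinct_eigenvalues by simp_all

lemma X_joint_subset:
  assumes "a \<in> X_joint \<kappa>" "\<kappa> \<in> \<Phi>"
  shows "a \<in> X \<kappa>"
proof -
  have "a \<in> X 0" if "a \<in> X_joint 0"
    using that unfolding X_joint_simps
    by (auto intro!: eigenspace_closed dest!: joint_X)
  then show ?thesis
    using assms joint_X[of a 1 0] joint_X[of a p 0] joint_X[of a 1 q] joint_X[of a p q]
    by (auto simp: X_joint_simps(1,3-5))
qed

lemma X_decomp:
  assumes "b \<in> alg (transps n)"
  shows "\<exists>g. (\<forall>\<kappa>\<in>\<Phi>. g \<kappa> \<in> X_joint \<kappa>) \<and> b = (\<Sum>\<kappa>\<in>\<Phi>. g \<kappa>)"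
proof -
  obtain b1 b0 b2 where b: "b1 \<in> eigenspace \<alpha> (transps n) e 1"
    "b0 \<in> eigenspace \<alpha> (transps n) e 0" "b2 \<in> eigenspace \<alpha> (transps n) e p" "b = b1 + b0 + b2"
    using E.decomp[OF assms] by blast
  obtain c1 c0 c2 where c: "b1 = c1 + c0 + c2" "c1 \<in> joint 1 1" "c0 \<in> joint 1 0" "c2 \<in> joint 1 q"
    using eigenspace_e_1[OF b(1)] .
  obtain d0 d2 where d: "b2 = d0 + d2" "d0 \<in> joint p 0" "d2 \<in> joint p q"
    using eigenspace_e_p[OF b(3)] .
  define g where "g \<kappa> = (if \<kappa> = 1 then c0 else if \<kappa> = 0 then c1 + b0 else if \<kappa> = p then d0
    else if \<kappa> = 1 - q then c2 else d2)" for \<kappa>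
  have g: "g 1 = c0" "g 0 = c1 + b0" "g p = d0" "g (1 - q) = c2" "g (p - q) = d2"
    using distinct_eigenvalues by (simp_all add: g_def)
  have X0: "c1 + b0 \<in> X_joint 0"
    unfolding X_joint_simps using c(2) eigenspace_e_0[OF b(2)] by blast
  have "g \<kappa> \<in> X_joint \<kappa>" if "\<kappa> \<in> \<Phi>" for \<kappa>
    using that c(3,4) d(2,3) X0 by (auto simp: g X_joint_simps(1,3-5))
  moreover have "(\<Sum>\<kappa>\<in>\<Phi>. g \<kappa>) = c0 + (c1 + b0) + d0 + c2 + d2"
    using distinct_eigenvalues distinct_eigenvalues[symmetric] by (simp add: g add.assoc)
  then have "b = (\<Sum>\<kappa>\<in>\<Phi>. g \<kappa>)" unfolding b(4) c(1) d(1) by (simp add: algebra_simps)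
  ultimately show ?thesis by blast
qed

text \<open>The joint pieces span the algebra, so by independence an eigenvector of
  \<open>e - f\<close> has no part outside the piece of its own eigenvalue.\<close>

lemma X_eq: "\<kappa> \<in> \<Phi> \<Longrightarrow> X \<kappa> = X_joint \<kappa>"
proof (intro equalityI subsetI)
  fix a assume \<kappa>: "\<kappa> \<in> \<Phi>" and a: "a \<in> X \<kappa>"
  then have an: "a \<in> alg (transps n)" by (simp add: eigenspace_def)
  obtain g where g: "\<forall>\<kappa>\<in>\<Phi>. g \<kappa> \<in> X_joint \<kappa>" "a = (\<Sum>\<kappa>\<in>\<Phi>. g \<kappa>)"
    using X_decomp[OF an] by blast
  have "a = g \<kappa>"
  proof (rule eigenspace_component[OF _ _ g(2) \<kappa> a])
    show "g \<mu> \<in> X \<mu>" if "\<mu> \<in> \<Phi>" for \<mu> using that g(1) X_joint_subset by blast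
  qed simp
  then show "a \<in> X_joint \<kappa>" using g(1) \<kappa> by blast
qed (rule X_joint_subset)

lemma decomposition_unique:
  assumes "b \<in> alg (transps n)"
  shows "\<exists>!g. g \<in> (\<Pi>\<^sub>E \<kappa>\<in>\<Phi>. X \<kappa>) \<and> b = (\<Sum>\<kappa>\<in>\<Phi>. g \<kappa>)"
proof -
  obtain g where g: "\<forall>\<kappa>\<in>\<Phi>. g \<kappa> \<in> X_joint \<kappa>" "b = (\<Sum>\<kappa>\<in>\<Phi>. g \<kappa>)"
    using X_decomp[OF assms] by blast
  show ?thesis
  \<comment> \<open>The extensional product requires the value \<open>undefined\<close> outside
    \<Phi>, hence the restriction.\<close>
  proof (rule ex1I[of _ "restrict g \<Phi>"])
    have "b = (\<Sum>\<kappa>\<in>\<Phi>. restrict g \<Phi> \<kappa>)"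
      unfolding g(2) by (rule sum.cong) (simp_all del: insert_iff)
    moreover have "restrict g \<Phi> \<in> (\<Pi>\<^sub>E \<kappa>\<in>\<Phi>. X \<kappa>)"
      using g(1) X_joint_subset by (intro restrict_PiE_iff[THEN iffD2]) blast
    ultimately show "restrict g \<Phi> \<in> (\<Pi>\<^sub>E \<kappa>\<in>\<Phi>. X \<kappa>) \<and> b = (\<Sum>\<kappa>\<in>\<Phi>. restrict g \<Phi> \<kappa>)"
      by blast
    fix h assume h: "h \<in> (\<Pi>\<^sub>E \<kappa>\<in>\<Phi>. X \<kappa>) \<and> b = (\<Sum>\<kappa>\<in>\<Phi>. h \<kappa>)"
    have 0: "(\<Sum>\<kappa>\<in>\<Phi>. h \<kappa> - g \<kappa>) = 0"
      using h g(2) by (simp only: sum_subtractf) simp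
    have hg: "h \<kappa> - g \<kappa> \<in> X \<kappa>" if \<kappa>: "\<kappa> \<in> \<Phi>" for \<kappa>
    proof (rule eigenspace_closed)
      show "h \<kappa> \<in> X \<kappa>" using h \<kappa> by (blast intro: PiE_mem)
      show "g \<kappa> \<in> X \<kappa>" using g(1) \<kappa> X_joint_subset by blast
    qed
    have hg: "h \<kappa> - g \<kappa> = 0" if \<kappa>: "\<kappa> \<in> \<Phi>" for \<kappa>
      by (rule eigenspace_independent[OF _ hg 0 \<kappa>]) simp_all
    have "h \<kappa> = restrict g \<Phi> \<kappa>" for \<kappa>
    proof (cases "\<kappa> \<in> \<Phi>")
      case True
      then show ?thesis using hg[OF True] by (simp del: insert_iff)
    next
      case False
      then show ?thesis using PiE_arb[OF conjunct1[OF h] False] by (simp del: insert_iff)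
    qed
    then show "h = restrict g \<Phi>" by blast
  qed
qed

section \<open>Fusion of the eigenspaces of \<open>e - f\<close>\<close>

lemma joint_XS: "a \<in> joint \<kappa> \<mu> \<Longrightarrow> \<kappa> - \<mu> \<in> \<Lambda> \<Longrightarrow> a \<in> XS \<Lambda>"
  by (rule eigenspace_sumI[OF joint_X])

lemma e_1_XS: "a \<in> eigenspace \<alpha> (transps n) e 1 \<Longrightarrow> a \<in> XS {1, 0, 1 - q}"
  by (erule eigenspace_e_1) (hypsubst, (intro eigenspace_sum_add; erule joint_XS; simp))

lemma e_p_XS: "a \<in> eigenspace \<alpha> (transps n) e p \<Longrightarrow> a \<in> XS {p, p - q}"
  by (erule eigenspace_e_p) (hypsubst, (intro eigenspace_sum_add; erule joint_XS; simp))

lemma f_0_XS: "a \<in> eigenspace \<alpha> (transps n) f 0 \<Longrightarrow> a \<in> XS {1, 0, p}"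
  by (erule eigenspace_f_0) (hypsubst, (intro eigenspace_sum_add; erule joint_XS; simp))

lemma f_q_XS: "a \<in> eigenspace \<alpha> (transps n) f q \<Longrightarrow> a \<in> XS {1 - q, p - q}"
  by (erule eigenspace_f_q) (hypsubst, (intro eigenspace_sum_add; erule joint_XS; simp))

lemma X_0_mult_XS:
  assumes "a \<in> X 0" "b \<in> joint \<kappa> \<mu>" "\<kappa> - \<mu> \<in> \<Lambda>"
  shows "a \<odot> b \<in> XS \<Lambda>"
proof -
  obtain u v where uv: "a = u + v" "u \<in> joint 1 1" "v \<in> joint 0 0"
    using assms(1) by (auto simp: X_eq X_joint_simps)
  have "u \<odot> b \<in> joint \<kappa> \<mu>" "v \<odot> b \<in> joint \<kappa> \<mu>"
    using assms(2) uv(2,3) by (auto intro: joint_mult)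
  then have "u \<odot> b \<in> XS \<Lambda>" "v \<odot> b \<in> XS \<Lambda>"
    using assms(3) by (auto intro: joint_XS)
  then show ?thesis unfolding uv(1) mprod_add_left by (rule eigenspace_sum_add)
qed

text \<open>If a factor has eigenvalue 1 or 0 for one axis, the product stays in the eigenspace of
  the other factor for that axis; the possible pairs then give the admissible eigenvalues of
  \<open>e - f\<close>. The product of two \<open>p - q\<close> eigenvectors is not
  restricted.\<close>

lemma fusion:
  assumes T: "(\<kappa>, \<mu>, S) \<in> coset_table p q" and a: "a \<in> X \<kappa>" and b: "b \<in> X \<mu>"
  shows "a \<odot> b \<in> XS S"
proof -
  let ?u = "1 - q" and ?v = "p - q"
  have J: "X 1 = joint 1 0" "X p = joint p 0" "X ?u = joint 1 q" "X ?v = joint p q"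
    using X_eq X_joint_simps by simp_all
  have 1: "a \<odot> b \<in> XS \<Lambda>" if "a \<in> joint 1 0" "b \<in> joint \<kappa>' \<mu>'" "\<kappa>' - \<mu>' \<in> \<Lambda>" for \<kappa>' \<mu>' \<Lambda>
    using joint_mult[OF that(1,2)] that(3) by (simp add: joint_XS)
  have X0: "\<exists>c d. z = c + d \<and> c \<in> joint 1 1 \<and> d \<in> joint 0 0" if "z \<in> X 0" for z
    using that X_eq[of 0] X_joint_simps(2) by auto
  from T show ?thesis
    unfolding coset_table_def insert_iff empty_iff prod.inject
  proof (elim disjE conjE FalseE)
    \<comment> \<open>Both parts of \<open>b\<close> are killed: \<open>c\<close> and
      \<open>a\<close> have eigenvalues 1 and 0 for \<open>f\<close>, while \<open>a\<close> and
      \<open>d\<close> have eigenvalues 1 and 0 for \<open>e\<close>.\<close>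
    assume e: "\<kappa> = 1" "\<mu> = 0" "S = {}"
    have aj: "a \<in> joint 1 0" using a e(1) J by simp
    obtain c d where cd: "b = c + d" "c \<in> joint 1 1" "d \<in> joint 0 0"
      using X0 b e(2) by blast
    have "c \<odot> a = 0" by (rule F.mult_1_0) (use aj cd in \<open>simp_all add: joint_def\<close>)
    moreover have "a \<odot> d = 0" by (rule E.mult_1_0) (use aj cd in \<open>simp_all add: joint_def\<close>)
    ultimately have "a \<odot> b = 0"
      using mprod_commute[of \<alpha> n a c] by (simp add: cd(1) mprod_add_right)
    then show ?thesis by (simp add: zero_in_eigenspace_sum)
  next
    assume e: "\<kappa> = 0" "\<mu> = 0" "S = {0}"
    obtain c d where cd: "b = c + d" "c \<in> joint 1 1" "d \<in> joint 0 0"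
      using X0 b e(2) by blast
    have "a \<odot> c \<in> XS S" "a \<odot> d \<in> XS S"
      using a e by (auto intro: X_0_mult_XS cd(2,3))
    then show ?thesis unfolding cd(1) mprod_add_right by (rule eigenspace_sum_add)
  next
    assume e: "\<kappa> = p" "\<mu> = p" "S = {1, 0, p}"
    have "a \<odot> b \<in> eigenspace \<alpha> (transps n) f 0"
      using a b e J F.mult_0[of a b 0] by (simp add: joint_def)
    then show ?thesis using e f_0_XS by simp
  next
    \<comment> \<open>Here both axes give information: \<open>a\<close> has eigenvalue 0 for
      \<open>f\<close> and \<open>b\<close> has eigenvalue 1 for \<open>e\<close>, which pins the
      product to the pair \<open>(p, q)\<close>.\<close>
    assume e: "\<kappa> = p" "\<mu> = ?u" "S = {?v}"
    have "a \<odot> b \<in> joint p q"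
      using a b e J F.mult_0[of a b q] E.mult_1[of b a p] mprod_commute[of \<alpha> n a b]
      by (simp add: joint_def)
    then show ?thesis using e by (simp add: joint_XS)
  next
    assume e: "\<kappa> = p" "\<mu> = ?v" "S = {?u, ?v}"
    have "a \<odot> b \<in> eigenspace \<alpha> (transps n) f q"
      using a b e J F.mult_0[of a b q] by (simp add: joint_def)
    then show ?thesis using e f_q_XS by simp
  next
    assume e: "\<kappa> = ?u" "\<mu> = ?u" "S = {1, 0, ?u}"
    have "a \<odot> b \<in> eigenspace \<alpha> (transps n) e 1"
      using a b e J E.mult_1[of a b 1] by (simp add: joint_def)
    then show ?thesis using e e_1_XS by simp
  next
    assume e: "\<kappa> = ?u" "\<mu> = ?v" "S = {p, ?v}"
    have "a \<odot> b \<in> eigenspace \<alpha> (transps n) e p"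
      using a b e J E.mult_1[of a b p] by (simp add: joint_def)
    then show ?thesis using e e_p_XS by simp
  next
    assume e: "\<kappa> = ?v" "\<mu> = ?v" "S = \<Phi>"
    obtain g where g: "\<forall>\<kappa>\<in>\<Phi>. g \<kappa> \<in> X_joint \<kappa>" "a \<odot> b = (\<Sum>\<kappa>\<in>\<Phi>. g \<kappa>)"
      using X_decomp[OF mprod_range] by blast
    have "\<forall>\<kappa>\<in>\<Phi>. g \<kappa> \<in> X \<kappa>" using g(1) X_eq by blast
    then show ?thesis unfolding e(3) eigenspace_sum_def
      by (intro CollectI exI[of _ \<Phi>] exI[of _ g]) (use g(2) in simp)
  \<comment> \<open>In the remaining entries the first factor is built from pairs with entries 0 and
    1, so the product stays in the joint eigenspace of the second.\<close>
  qed (use a b J in \<open>auto intro: 1 X_0_mult_XS\<close>)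
qed

lemma axis_idem: "(e - f) \<odot> (e - f) = e - f"
proof -
  have "e \<odot> f = f" using f_below by (simp add: eigenspace_def scl_def)
  then show ?thesis
    using E.axis_idem F.axis_idem mprod_commute[of \<alpha> n f e]
    by (simp add: mprod_linear)
qed

lemma coset_fusion_rules:
  "satisfies_fusion_rules \<alpha> (transps n) \<Phi> (table_star (coset_table p q)) (e - f)"
  unfolding satisfies_fusion_rules_def
proof (intro conjI ballI)
  let ?T = "coset_table p q"
  have star: "table_star ?T \<kappa> \<mu> = S" "table_star ?T \<mu> \<kappa> = S" if "(\<kappa>, \<mu>, S) \<in> ?T" for \<kappa> \<mu> S
    using bspec[OF realizes_coset_table[OF distinct, unfolded realizes_table_def] that] by simp_all
  \<comment> \<open>The table lists each unordered pair once, so a given pair may occur only with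
    its entries exchanged.\<close>
  have ex: "\<exists>S. (\<kappa>, \<mu>, S) \<in> ?T \<or> (\<mu>, \<kappa>, S) \<in> ?T" if "\<kappa> \<in> \<Phi>" "\<mu> \<in> \<Phi>" for \<kappa> \<mu>
  proof -
    define T where "T = ?T"
    have "(1, 1, {1}) \<in> T" "(1, 0, {}) \<in> T" "(0, 0, {0}) \<in> T" "(1, p, {p}) \<in> T"
      "(1, 1 - q, {1 - q}) \<in> T" "(1, p - q, {p - q}) \<in> T" "(0, p, {p}) \<in> T"
      "(0, 1 - q, {1 - q}) \<in> T" "(0, p - q, {p - q}) \<in> T" "(p, p, {1, 0, p}) \<in> T"
      "(p, 1 - q, {p - q}) \<in> T" "(p, p - q, {1 - q, p - q}) \<in> T"
      "(1 - q, 1 - q, {1, 0, 1 - q}) \<in> T" "(1 - q, p - q, {p, p - q}) \<in> T"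
      "(p - q, p - q, \<Phi>) \<in> T"
      by (simp_all add: T_def coset_table_def)
    with that show ?thesis unfolding T_def[symmetric]
      by (elim insertE emptyE) (hypsubst, blast)+
  qed
  have sub: "S \<subseteq> \<Phi>" if "(\<kappa>, \<mu>, S) \<in> ?T" for \<kappa> \<mu> S
    using that unfolding coset_table_def insert_iff empty_iff prod.inject
    by (elim disjE conjE FalseE) simp_all
  show "fusion_rules \<Phi> (table_star ?T)"
    unfolding fusion_rules_def
  proof (intro conjI ballI)
    fix \<kappa> \<mu> assume "\<kappa> \<in> \<Phi>" "\<mu> \<in> \<Phi>"
    then obtain S where "(\<kappa>, \<mu>, S) \<in> ?T \<or> (\<mu>, \<kappa>, S) \<in> ?T" using ex by blast
    then have "table_star ?T \<kappa> \<mu> = S" "S \<subseteq> \<Phi>" using star sub by blast+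
    then show "table_star ?T \<kappa> \<mu> \<subseteq> \<Phi>" by simp
  qed simp
  show "e - f \<in> alg (transps n)"
    by (intro alg_closed E.axis_in_alg F.axis_in_alg)
  show "(e - f) \<odot> (e - f) = e - f" by (rule axis_idem)
  show "\<exists>!g. g \<in> (\<Pi>\<^sub>E \<kappa>\<in>\<Phi>. X \<kappa>) \<and> b = (\<Sum>\<kappa>\<in>\<Phi>. g \<kappa>)" if "b \<in> alg (transps n)" for b
    using that by (rule decomposition_unique)
  show "a \<odot> b \<in> XS (table_star ?T \<kappa> \<mu>)"
    if \<kappa>: "\<kappa> \<in> \<Phi>" and \<mu>: "\<mu> \<in> \<Phi>" and a: "a \<in> X \<kappa>" and b: "b \<in> X \<mu>" for \<kappa> \<mu> a b
  proof -
    from ex[OF \<kappa> \<mu>] consider S where "(\<kappa>, \<mu>, S) \<in> ?T" | S where "(\<mu>, \<kappa>, S) \<in> ?T" by blast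
    then show ?thesis
    proof cases
      case 1
      show ?thesis using fusion[OF 1 a b] star(1)[OF 1] by simp
    next
      case 2
      show ?thesis
        using fusion[OF 2 b a] star(2)[OF 2] mprod_commute[of \<alpha> n b a] by simp
    qed
  qed
qed

end

section \<open>The coset axis as a difference of nested axes\<close>

theorem theorem3p10:
  fixes \<alpha> :: "'f::field" and n m l :: nat
  assumes "(2::'f) \<noteq> 0"
    and "\<alpha> \<notin> {0, 1}"
    and "l < m" and "m \<le> n"
    and "admits_id n \<alpha> m" and "admits_id n \<alpha> l"
    and "distinct (coset_eigenvalues (eta \<alpha> m) (eta \<alpha> l))"
  shows "satisfies_fusion_rules \<alpha> (transps n)
           {1, 0, eta \<alpha> m, 1 - eta \<alpha> l, eta \<alpha> m - eta \<alpha> l}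
           (table_star (coset_table (eta \<alpha> m) (eta \<alpha> l)))
           (coset_axis n \<alpha> m l)"
proof -
  have a: "\<alpha> \<noteq> 0" and l: "l \<le> n" using assms by auto
  \<comment> \<open>For \<open>l\<close> this uses that \<open>1 - eta \<alpha> l\<close> differs
    from the eigenvalues 1 and 0.\<close>
  have eta: "eta \<alpha> m \<noteq> 0" "eta \<alpha> m \<noteq> 1" "eta \<alpha> l \<noteq> 0" "eta \<alpha> l \<noteq> 1"
    using assms(7) by (auto simp: coset_eigenvalues_def)
  \<comment> \<open>Division by zero yields zero, so a vanishing denominator would force
    \<open>eta \<alpha> i = 0\<close>.\<close>
  have N: "1 + \<alpha> * (of_nat i - 2) \<noteq> 0" if "eta \<alpha> i \<noteq> 0" for i
  proof
    assume "1 + \<alpha> * (of_nat i - 2) = 0"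
    then have "2 * (1 + \<alpha> * (of_nat i - 2)) = 0" by simp
    then have "2 + 2 * \<alpha> * (of_nat i - 2) = 0" by (simp add: algebra_simps)
    then show False using that by (simp add: eta_def)
  qed
  note Nm = N[OF eta(1)] and Nl = N[OF eta(3)]
  interpret peirce_axis_pair \<alpha> n "sym_id \<alpha> m" "sym_id \<alpha> l" "eta \<alpha> m" "eta \<alpha> l"
  proof (intro peirce_axis_pair.intro peirce_axis_pair_axioms.intro)
    show "peirce_axis \<alpha> n (sym_id \<alpha> m) (eta \<alpha> m)" "peirce_axis \<alpha> n (sym_id \<alpha> l) (eta \<alpha> l)"
      by (intro peirce_axis_sym_id assms(1,4) a l Nm Nl eta)+
    \<comment> \<open>The 1-eigenspaces are the subalgebras of the two subgroups, so both nesting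
      conditions reduce to this inclusion.\<close>
    have lm: "alg (transps l) \<subseteq> (alg (transps m) :: (perm \<Rightarrow> 'f) set)"
      using assms(3) by (intro alg_mono transps_mono) simp
    note E = eigenspace_sym_id_1[OF assms(1) a assms(4) Nm eta(1,2)]
      eigenspace_sym_id_1[OF assms(1) a l Nl eta(3,4)]
    show "sym_id \<alpha> l \<in> eigenspace \<alpha> (transps n) (sym_id \<alpha> m) 1"
      unfolding E using lm sym_id_in_alg[OF assms(1) a l Nl] by blast
    show "eigenspace \<alpha> (transps n) (sym_id \<alpha> l) 1 \<subseteq> eigenspace \<alpha> (transps n) (sym_id \<alpha> m) 1"
      unfolding E by (rule lm)
  qed (rule assms(7))
  have "coset_axis n \<alpha> m l = sym_id \<alpha> m - sym_id \<alpha> l"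
    unfolding coset_axis_def
    by (simp add: id_elt_closed_form assms(1,4) l Nm Nl sym_id_def transps_Int_Sym)
  then show ?thesis using coset_fusion_rules by simp
qed

end
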